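(* Work in one of the following two situations. In Situation $\mathfrak{m}$: put $\mathfrak{B}_v=\mathfrak{m}_v$ for $v\in \mathrm{S}(K)$ and equip $\mathrm{S}(K)$ with the topology $\mathcal{T}_{\mathrm{Zar}^*}$. In Situation $\mathcal{O}$: put $\mathfrak{B}_v=\mathcal{O}_v$ for $v\in \mathrm{S}(K)$ and equip $\mathrm{S}(K)$ with the Zariski topology $\mathcal{T}_{\mathrm{Zar}}$. Let $K$ be a field, $S_1,\dots,S_n\subseteq \mathrm{S}(K)$, $t\in K^\times$, $x_1,\dots,x_n\in K$ and $z_1,\dots,z_n\in K^\times$. Assume: (U) there exists $f\in K[X]$ of degree $d\ge 2$, with leading coefficient $a_d$, such that for all $v\in S_1\cup\dots\cup S_n$: (i) for any $x\in\mathcal{O}_v$, $f(x)\in\mathcal{O}_v$; (iii) for any $x\in K\setminus\mathcal{O}_v$, $f(x)\in x^d(\mathcal{O}_v\setminus t\mathfrak{m}_v)\cap(a_dx^d+x^{d-1}\mathcal{O}_v)$; (iv) $\mathcal{O}_v+\mathcal{O}_v\subseteq t^{-1}\mathcal{O}_v$; and such that for every $i$ for which $S_i$ is infinite and all $v\in S_i$: (ii) for any $x\in\mathcal{O}_v$, $f(x)\notin t\mathfrak{m}_v$; (T) each $S_i$ is compact in the given topology; (I) for any $i,j$ and any valuation $w$ on $K$ with a refinement in $S_i$ and a refinement in $S_j$ we have $w(x_i-x_j)\geq w(z_i)=w(z_j)$; further, the sets $S_i$ are pairwise $t$-independent, and in Situation $\mathfrak{m}$ they are furthermore pairwise incomparable.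 Then (in either situation) there exists $x\in K$ with $$x-x_i\in z_i\mathfrak{B}_v\quad\text{for all } v\in S_i,\ \text{for } i=1,\dots,n.$$
   Context: Localities. For a field $K$, $\mathrm{S}_{\mathrm{val}}(K)$ is the set of equivalence classes of Krull valuations (written additively, trivial one included), $\mathrm{S}_{\mathrm{ord}}(K)$ the set of orderings, $\mathrm{S}_{\mathrm{abs}}(K)$ the set of equivalence classes of absolute values. $\mathrm{S}(K)$ is their union, with rank-1 valuations and archimedean orderings identified with the associated absolute values (and the trivial absolute value with the trivial valuation); its elements are called localities. For $v\in\mathrm{S}(K)$: $\mathcal{O}_v=\{v(x)\ge0\}$, $\{-1\le_v x\le_v 1\}$, $\{|x|_v\le 1\}$ and $\mathfrak{m}_v=\{v(x)>0\}$, $\{-1<_v x<_v 1\}$, $\{|x|_v<1\}$ (subsets of $K$), according to whether $v$ is a valuation, ordering, or absolute value; $\mathcal{O}_v^\times=\mathcal{O}_v\setminus\mathfrak{m}_v$. A locality $v$ is determined by $\mathcal{O}_v$. Topologies on $\mathrm{S}(K)$: $\mathcal{T}_{\mathrm{Zar}}$ has open subbasis $\{v: x\in\mathcal{O}_v\}$, $x\in K$; $\mathcal{T}_{\mathrm{Zar}^*}$ has open subbasis $\{v: x\in\mathfrak{m}_v\}$, $x\in K$. Compact means quasi-compact. Order: if $\mathcal{O}_v\subseteq\mathcal{O}_w$, then $v$ is a refinement of $w$ and $w$ a coarsening of $v$ (equality allowed). Incomparable means neither refines the other. $v\vee w$ denotes the finest common coarsening of $v,w$ in $\mathrm{S}(K)$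 (it exists). If a valuation $w$ coarsens $v$, then $v$ induces a locality $\bar v\in\mathrm{S}(Kw)$ on the residue field $Kw$ ($\mathcal{O}_{\bar v}$ is the image of $\mathcal{O}_v$). Localities $v,w$ are strongly incomparable if they are incomparable and induce distinct localities on the residue field of $v\vee w$. For $t\in K^\times$, $v,w$ are $t$-independent if $t\in\mathcal{O}_{v\vee w}^\times$ and, additionally, $v,w$ are strongly incomparable in case both are orderings. Two sets of localities are incomparable (resp. $t$-independent) if every element of the first is incomparable (resp. $t$-independent) to every element of the second. *)

theory Defs
  imports
    "HOL-Analysis.Analysis"
    "HOL-Algebra.QuotRing"
    "HOL-Algebra.Algebraic_Closure_Type"
    "HOL-Library.Set_Algebras"
begin

text \<open>
  Localities are needed both for the ground field and for residue fields, which are quotients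
  of subrings. They are therefore defined for a field \<open>K\<close> given as a structure with explicit
  carrier; a field given as a type is viewed as such a structure by
  \<^const>\<open>ring_of_type_algebra\<close>.
\<close>

section \<open>Krull valuations, orderings, absolute values\<close>

definition ordered_abelian_group :: "'g monoid \<Rightarrow> 'g rel \<Rightarrow> bool" where
  "ordered_abelian_group \<Gamma> r \<longleftrightarrow>
     comm_group \<Gamma> \<and> linear_order_on (carrier \<Gamma>) r \<and>
     (\<forall>a b c. (a, b) \<in> r \<longrightarrow> c \<in> carrier \<Gamma> \<longrightarrow> (a \<otimes>\<^bsub>\<Gamma>\<^esub> c, b \<otimes>\<^bsub>\<Gamma>\<^esub> c) \<in> r)"

text \<open>
  Additive Krull valuations take values in \<open>\<Gamma> \<union> {\<infinity>}\<close>, encoded as an option type with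
  \<^const>\<open>None\<close> for \<open>\<infinity>\<close>. The library writes abelian groups multiplicatively,
  so that the value \<open>0\<close> of \<open>\<Gamma>\<close> appears as \<open>\<one>\<^bsub>\<Gamma>\<^esub>\<close>.
\<close>

definition val_le :: "'g rel \<Rightarrow> 'g option \<Rightarrow> 'g option \<Rightarrow> bool" where
  "val_le r a b \<longleftrightarrow>
     (case b of None \<Rightarrow> True
      | Some b' \<Rightarrow> (case a of None \<Rightarrow> False | Some a' \<Rightarrow> (a', b') \<in> r))"

definition val_add :: "'g monoid \<Rightarrow> 'g option \<Rightarrow> 'g option \<Rightarrow> 'g option" where
  "val_add \<Gamma> a b =
     (case a of None \<Rightarrow> None
      | Some a' \<Rightarrow> (case b of None \<Rightarrow> None | Some b' \<Rightarrow> Some (a' \<otimes>\<^bsub>\<Gamma>\<^esub> b')))"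

text \<open>The last clause says \<open>min (v x) (v y) \<le> v (x + y)\<close>.\<close>

definition krull_valuation ::
    "'a ring \<Rightarrow> 'g monoid \<Rightarrow> 'g rel \<Rightarrow> ('a \<Rightarrow> 'g option) \<Rightarrow> bool" where
  "krull_valuation K \<Gamma> r v \<longleftrightarrow>
     ordered_abelian_group \<Gamma> r \<and>
     (\<forall>x\<in>carrier K. v x \<in> insert None (Some ` carrier \<Gamma>)) \<and>
     (\<forall>x\<in>carrier K. v x = None \<longleftrightarrow> x = \<zero>\<^bsub>K\<^esub>) \<and>
     (\<forall>x\<in>carrier K. \<forall>y\<in>carrier K. v (x \<otimes>\<^bsub>K\<^esub> y) = val_add \<Gamma> (v x) (v y)) \<and>
     (\<forall>x\<in>carrier K. \<forall>y\<in>carrier K.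
        val_le r (v x) (v (x \<oplus>\<^bsub>K\<^esub> y)) \<or> val_le r (v y) (v (x \<oplus>\<^bsub>K\<^esub> y)))"

definition field_ordering :: "'a ring \<Rightarrow> 'a rel \<Rightarrow> bool" where
  "field_ordering K r \<longleftrightarrow>
     linear_order_on (carrier K) r \<and>
     (\<forall>x y z. (x, y) \<in> r \<longrightarrow> z \<in> carrier K \<longrightarrow> (x \<oplus>\<^bsub>K\<^esub> z, y \<oplus>\<^bsub>K\<^esub> z) \<in> r) \<and>
     (\<forall>x y. (\<zero>\<^bsub>K\<^esub>, x) \<in> r \<longrightarrow> (\<zero>\<^bsub>K\<^esub>, y) \<in> r \<longrightarrow> (\<zero>\<^bsub>K\<^esub>, x \<otimes>\<^bsub>K\<^esub> y) \<in> r)"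

definition absolute_value :: "'a ring \<Rightarrow> ('a \<Rightarrow> real) \<Rightarrow> bool" where
  "absolute_value K a \<longleftrightarrow>
     (\<forall>x\<in>carrier K. a x \<ge> 0 \<and> (a x = 0 \<longleftrightarrow> x = \<zero>\<^bsub>K\<^esub>)) \<and>
     (\<forall>x\<in>carrier K. \<forall>y\<in>carrier K. a (x \<otimes>\<^bsub>K\<^esub> y) = a x * a y) \<and>
     (\<forall>x\<in>carrier K. \<forall>y\<in>carrier K. a (x \<oplus>\<^bsub>K\<^esub> y) \<le> a x + a y)"


section \<open>Localities\<close>

text \<open>
  A place is a single valuation, ordering or absolute value; localities are classes of places.
  Letting value groups have elements of type \<^typ>\<open>'a set\<close> loses no equivalence class: the
  value group of \<open>v\<close> is isomorphic to the quotient of the multiplicative group by the units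
  of the valuation ring, whose elements are cosets.
\<close>

datatype 'a place =
    Valuation "'a set monoid" "'a set rel" "'a \<Rightarrow> 'a set option"
  | Ordering "'a rel"
  | Absolute_Value "'a \<Rightarrow> real"

fun is_place :: "'a ring \<Rightarrow> 'a place \<Rightarrow> bool" where
  "is_place K (Valuation \<Gamma> r v) \<longleftrightarrow> krull_valuation K \<Gamma> r v"
| "is_place K (Ordering r) \<longleftrightarrow> field_ordering K r"
| "is_place K (Absolute_Value a) \<longleftrightarrow> absolute_value K a"

text \<open>
  The equivalence relation generated by equivalence of valuations (order isomorphism of the
  value groups compatible with the valuations), equivalence of absolute values, and the
  identification of rank-1 valuations and archimedean orderings with their associated absolute
  values. In rule \<open>val_abs\<close>, \<open>\<phi>\<close> is an order embedding of the value group into the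
  reals, which is additive because the absolute value is multiplicative; hence the rank is at
  most 1, and rank 0 is the identification of the trivial valuation with the trivial absolute
  value. In rule \<open>ord_abs\<close>, the existence of \<open>\<sigma>\<close> says that the ordering is archimedean.
\<close>

inductive place_equiv :: "'a ring \<Rightarrow> 'a place \<Rightarrow> 'a place \<Rightarrow> bool" for K where
  val_val: "place_equiv K (Valuation \<Gamma> r v) (Valuation \<Delta> s w)"
    if "krull_valuation K \<Gamma> r v" "krull_valuation K \<Delta> s w"
       "\<forall>x\<in>carrier K. \<forall>y\<in>carrier K. val_le r (v x) (v y) \<longleftrightarrow> val_le s (w x) (w y)"
| abs_abs: "place_equiv K (Absolute_Value a) (Absolute_Value b)"
    if "absolute_value K a" "absolute_value K b"
       "c > 0" "\<forall>x\<in>carrier K. b x = a x powr c"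
| val_abs: "place_equiv K (Valuation \<Gamma> r v) (Absolute_Value a)"
    if "krull_valuation K \<Gamma> r v" "absolute_value K a"
       "\<forall>x\<in>carrier K - {\<zero>\<^bsub>K\<^esub>}. a x = exp (- \<phi> (the (v x)))"
       "\<forall>x\<in>carrier K - {\<zero>\<^bsub>K\<^esub>}. \<forall>y\<in>carrier K - {\<zero>\<^bsub>K\<^esub>}.
          \<phi> (the (v x)) \<le> \<phi> (the (v y)) \<longleftrightarrow> (the (v x), the (v y)) \<in> r"
| ord_abs: "place_equiv K (Ordering r) (Absolute_Value a)"
    if "field_ordering K r" "absolute_value K a"
       "\<sigma> \<in> ring_hom K ring_of_type_algebra"
       "\<forall>x\<in>carrier K. \<forall>y\<in>carrier K. (x, y) \<in> r \<longleftrightarrow> \<sigma> x \<le> \<sigma> y"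
       "\<forall>x\<in>carrier K. a x = \<bar>\<sigma> x\<bar>"
| refl: "place_equiv K p p" if "is_place K p"
| sym: "place_equiv K p q" if "place_equiv K q p"
| trans: "place_equiv K p q" if "place_equiv K p p'" "place_equiv K p' q"

type_synonym 'a locality = "'a place set"

definition locality_of :: "'a ring \<Rightarrow> 'a place \<Rightarrow> 'a locality" where
  "locality_of K p = {q. place_equiv K p q}"

definition localities :: "'a ring \<Rightarrow> 'a locality set" where
  "localities K = locality_of K ` {p. is_place K p}"

definition S_ord :: "'a ring \<Rightarrow> 'a locality set" where
  "S_ord K = {locality_of K (Ordering r) | r. field_ordering K r}"

fun place_O :: "'a ring \<Rightarrow> 'a place \<Rightarrow> 'a set" where
  "place_O K (Valuation \<Gamma> r v) = {x \<in> carrier K. val_le r (Some \<one>\<^bsub>\<Gamma>\<^esub>) (v x)}"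
| "place_O K (Ordering r) = {x \<in> carrier K. (\<ominus>\<^bsub>K\<^esub> \<one>\<^bsub>K\<^esub>, x) \<in> r \<and> (x, \<one>\<^bsub>K\<^esub>) \<in> r}"
| "place_O K (Absolute_Value a) = {x \<in> carrier K. a x \<le> 1}"

fun place_m :: "'a ring \<Rightarrow> 'a place \<Rightarrow> 'a set" where
  "place_m K (Valuation \<Gamma> r v) =
     {x \<in> carrier K. val_le r (Some \<one>\<^bsub>\<Gamma>\<^esub>) (v x) \<and> v x \<noteq> Some \<one>\<^bsub>\<Gamma>\<^esub>}"
| "place_m K (Ordering r) =
     {x \<in> carrier K. (\<ominus>\<^bsub>K\<^esub> \<one>\<^bsub>K\<^esub>, x) \<in> r \<and> x \<noteq> \<ominus>\<^bsub>K\<^esub> \<one>\<^bsub>K\<^esub> \<and> (x, \<one>\<^bsub>K\<^esub>) \<in> r \<and> x \<noteq> \<one>\<^bsub>K\<^esub>}"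
| "place_m K (Absolute_Value a) = {x \<in> carrier K. a x < 1}"

lemma val_one:
  assumes "field K" "krull_valuation K \<Gamma> r v"
  shows "v \<one>\<^bsub>K\<^esub> = Some \<one>\<^bsub>\<Gamma>\<^esub>"
proof -
  interpret field K by fact
  interpret G: comm_group \<Gamma> using assms(2) by (auto simp: krull_valuation_def ordered_abelian_group_def)
  have n: "v \<one>\<^bsub>K\<^esub> \<noteq> None" and 1: "v \<one>\<^bsub>K\<^esub> = val_add \<Gamma> (v \<one>\<^bsub>K\<^esub>) (v \<one>\<^bsub>K\<^esub>)"
    and c: "v \<one>\<^bsub>K\<^esub> \<in> insert None (Some ` carrier \<Gamma>)"
    using assms(2) one_not_zero unfolding krull_valuation_def by (metis one_closed, metis one_closed r_one, metis one_closed)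
  then obtain g where "v \<one>\<^bsub>K\<^esub> = Some g" "g \<in> carrier \<Gamma>" by auto
  with 1 show ?thesis by (simp add: val_add_def G.l_cancel_one')
qed

lemma abs_one:
  assumes "field K" "absolute_value K a"
  shows "a \<one>\<^bsub>K\<^esub> = 1"
proof -
  interpret field K by fact
  have "a \<one>\<^bsub>K\<^esub> \<noteq> 0" "a \<one>\<^bsub>K\<^esub> = a \<one>\<^bsub>K\<^esub> * a \<one>\<^bsub>K\<^esub>"
    using assms(2) one_not_zero unfolding absolute_value_def
    by (metis one_closed, metis one_closed r_one)
  then show ?thesis by simp
qed

lemma val_le_eq_one_iff:
  assumes "ordered_abelian_group \<Gamma> r" "g \<in> carrier \<Gamma>"
  shows "a = Some g \<longleftrightarrow> val_le r a (Some g) \<and> val_le r (Some g) a"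
proof (cases a)
  case None
  then show ?thesis by (simp add: val_le_def)
next
  case (Some h)
  have "(g, g) \<in> r" "\<And>x y. (x, y) \<in> r \<Longrightarrow> (y, x) \<in> r \<Longrightarrow> x = y"
    using assms unfolding ordered_abelian_group_def order_on_defs refl_on_def antisym_def by blast+
  then show ?thesis unfolding Some val_le_def by auto
qed

lemma place_equiv_O_m:
  assumes "place_equiv K p q" "field K"
  shows "place_O K p = place_O K q \<and> place_m K p = place_m K q"
  using assms
proof (induction rule: place_equiv.induct)
  case (val_val \<Gamma> r v \<Delta> s w)
  interpret field K by fact
  have o: "v \<one>\<^bsub>K\<^esub> = Some \<one>\<^bsub>\<Gamma>\<^esub>" "w \<one>\<^bsub>K\<^esub> = Some \<one>\<^bsub>\<Delta>\<^esub>"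
    using val_one val_val by blast+
  have rv: "ordered_abelian_group \<Gamma> r" and sw: "ordered_abelian_group \<Delta> s"
    using val_val(1,2) by (simp_all add: krull_valuation_def)
  have "v \<one>\<^bsub>K\<^esub> \<in> insert None (Some ` carrier \<Gamma>)" "w \<one>\<^bsub>K\<^esub> \<in> insert None (Some ` carrier \<Delta>)"
    using val_val(1,2) one_closed unfolding krull_valuation_def by blast+
  then have c: "\<one>\<^bsub>\<Gamma>\<^esub> \<in> carrier \<Gamma>" "\<one>\<^bsub>\<Delta>\<^esub> \<in> carrier \<Delta>"
    unfolding o by auto
  have le: "val_le r (Some \<one>\<^bsub>\<Gamma>\<^esub>) (v x) \<longleftrightarrow> val_le s (Some \<one>\<^bsub>\<Delta>\<^esub>) (w x)"
     "val_le r (v x) (Some \<one>\<^bsub>\<Gamma>\<^esub>) \<longleftrightarrow> val_le s (w x) (Some \<one>\<^bsub>\<Delta>\<^esub>)" if "x \<in> carrier K" for x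
    using val_val(3) that one_closed unfolding o[symmetric] by blast+
  have eq: "v x = Some \<one>\<^bsub>\<Gamma>\<^esub> \<longleftrightarrow> w x = Some \<one>\<^bsub>\<Delta>\<^esub>" if x: "x \<in> carrier K" for x
    unfolding val_le_eq_one_iff[OF rv c(1)] val_le_eq_one_iff[OF sw c(2)] le[OF x] ..
  show ?case using le eq by auto
next
  case (abs_abs a b c)
  have "a x powr c \<le> 1 \<longleftrightarrow> a x \<le> 1" "a x powr c < 1 \<longleftrightarrow> a x < 1" if "x \<in> carrier K" for x
  proof -
    have "a x \<ge> 0" using abs_abs(1) that by (auto simp: absolute_value_def)
    then have lt: "a x powr c < 1" if "a x < 1"
      using powr_less_mono2[OF abs_abs(3) _ that] by simp
    have gt: "1 < a x powr c" if "1 < a x"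
      using powr_less_mono2[OF abs_abs(3) _ that] by simp
    consider "a x < 1" | "a x = 1" | "1 < a x" by linarith
    then have "(a x powr c \<le> 1 \<longleftrightarrow> a x \<le> 1) \<and> (a x powr c < 1 \<longleftrightarrow> a x < 1)"
    proof cases
      case 1
      with lt[OF 1] show ?thesis by linarith
    next
      case 2
      then show ?thesis by simp
    next
      case 3
      with gt[OF 3] show ?thesis by linarith
    qed
    then show "a x powr c \<le> 1 \<longleftrightarrow> a x \<le> 1" "a x powr c < 1 \<longleftrightarrow> a x < 1"
      by blast+
  qed
  then show ?case using abs_abs(4) by (simp cong: conj_cong)
next
  case (val_abs \<Gamma> r v a \<phi>)
  interpret field K by fact
  have o: "v \<one>\<^bsub>K\<^esub> = Some \<one>\<^bsub>\<Gamma>\<^esub>" "a \<one>\<^bsub>K\<^esub> = 1"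
    using val_one abs_one val_abs by blast+
  have ph0: "\<phi> \<one>\<^bsub>\<Gamma>\<^esub> = 0" using val_abs(3)[rule_format, of "\<one>\<^bsub>K\<^esub>"] o by auto
  have og: "ordered_abelian_group \<Gamma> r"
    using val_abs(1) by (simp add: krull_valuation_def)
  have vc: "\<forall>x\<in>carrier K. v x \<in> insert None (Some ` carrier \<Gamma>)"
    using val_abs(1) unfolding krull_valuation_def by (elim conjE)
  have vz: "\<forall>x\<in>carrier K. v x = None \<longleftrightarrow> x = \<zero>\<^bsub>K\<^esub>"
    using val_abs(1) unfolding krull_valuation_def by (elim conjE)
  have az: "\<forall>x\<in>carrier K. a x = 0 \<longleftrightarrow> x = \<zero>\<^bsub>K\<^esub>"
    using val_abs(2) by (simp add: absolute_value_def)
  have "(val_le r (Some \<one>\<^bsub>\<Gamma>\<^esub>) (v x) \<longleftrightarrow> a x \<le> 1) \<and>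
      (v x = Some \<one>\<^bsub>\<Gamma>\<^esub> \<longleftrightarrow> a x = 1)"
    if x: "x \<in> carrier K" for x
  proof (cases "x = \<zero>\<^bsub>K\<^esub>")
    case True
    have "v x = None" "a x = 0"
      using vz az x True by simp_all
    then show ?thesis by (simp add: val_le_def)
  next
    case False
    have "v x \<noteq> None" "v x \<in> insert None (Some ` carrier \<Gamma>)"
      using vz x False bspec[OF vc x] by simp_all
    then obtain g where g: "v x = Some g" "g \<in> carrier \<Gamma>" by auto
    have a: "a x = exp (- \<phi> g)" using val_abs(3) x False g by auto
    have xx: "x \<in> carrier K - {\<zero>\<^bsub>K\<^esub>}" "\<one>\<^bsub>K\<^esub> \<in> carrier K - {\<zero>\<^bsub>K\<^esub>}"
      using x False by simp_all
    have "0 \<le> \<phi> g \<longleftrightarrow> (\<one>\<^bsub>\<Gamma>\<^esub>, g) \<in> r"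
      using bspec[OF bspec[OF val_abs(4) xx(2)] xx(1)] by (simp add: o g ph0)
    moreover have "\<phi> g \<le> 0 \<longleftrightarrow> (g, \<one>\<^bsub>\<Gamma>\<^esub>) \<in> r"
      using bspec[OF bspec[OF val_abs(4) xx(1)] xx(2)] by (simp add: o g ph0)
    moreover have "g = \<one>\<^bsub>\<Gamma>\<^esub> \<longleftrightarrow> (g, \<one>\<^bsub>\<Gamma>\<^esub>) \<in> r \<and> (\<one>\<^bsub>\<Gamma>\<^esub>, g) \<in> r"
      using val_le_eq_one_iff[OF og g(2), of "Some \<one>\<^bsub>\<Gamma>\<^esub>"] by (auto simp: val_le_def)
    ultimately show ?thesis by (auto simp: val_le_def g a)
  qed
  then show ?case by auto
next
  case (ord_abs r a \<sigma>)
  interpret field K by fact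
  have one: "\<sigma> \<one>\<^bsub>K\<^esub> = 1"
    and add: "\<And>x y. x \<in> carrier K \<Longrightarrow> y \<in> carrier K \<Longrightarrow> \<sigma> (x \<oplus>\<^bsub>K\<^esub> y) = \<sigma> x + \<sigma> y"
    using ord_abs(3) by (auto simp: ring_hom_def ring_of_type_algebra_def)
  have "\<sigma> \<zero>\<^bsub>K\<^esub> = 0" using add[of "\<zero>\<^bsub>K\<^esub>" "\<zero>\<^bsub>K\<^esub>"] by simp
  then have m: "\<sigma> (\<ominus>\<^bsub>K\<^esub> \<one>\<^bsub>K\<^esub>) = -1" using add[of "\<one>\<^bsub>K\<^esub>" "\<ominus>\<^bsub>K\<^esub> \<one>\<^bsub>K\<^esub>"] one r_neg by auto
  have "antisym r"
    using ord_abs(1) by (simp add: field_ordering_def order_on_defs)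
  then have inj: "\<sigma> x = \<sigma> y \<longleftrightarrow> x = y" if "x \<in> carrier K" "y \<in> carrier K" for x y
    using bspec[OF bspec[OF ord_abs(4) that(1)] that(2)] bspec[OF bspec[OF ord_abs(4) that(2)] that(1)]
    by (auto dest: antisymD)
  have c: "\<one>\<^bsub>K\<^esub> \<in> carrier K" "\<ominus>\<^bsub>K\<^esub> \<one>\<^bsub>K\<^esub> \<in> carrier K" by simp_all
  have "((\<ominus>\<^bsub>K\<^esub> \<one>\<^bsub>K\<^esub>, x) \<in> r \<longleftrightarrow> -1 \<le> \<sigma> x) \<and> ((x, \<one>\<^bsub>K\<^esub>) \<in> r \<longleftrightarrow> \<sigma> x \<le> 1) \<and>
      (x = \<ominus>\<^bsub>K\<^esub> \<one>\<^bsub>K\<^esub> \<longleftrightarrow> \<sigma> x = -1) \<and> (x = \<one>\<^bsub>K\<^esub> \<longleftrightarrow> \<sigma> x = 1) \<and> a x = \<bar>\<sigma> x\<bar>"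
    if x: "x \<in> carrier K" for x
    using bspec[OF bspec[OF ord_abs(4) c(2)] x] bspec[OF bspec[OF ord_abs(4) x] c(1)]
      inj[OF x c(1)] inj[OF x c(2)] bspec[OF ord_abs(5) x] by (simp add: one m)
  then show ?case
    by (auto simp: one m abs_le_iff abs_less_iff)
next
  case (sym p q)
  then show ?case by simp
next
  case (trans p p' q)
  then show ?case by simp
qed simp

text \<open>By the preceding lemma, the following are unions of equal sets.\<close>

definition loc_O :: "'a ring \<Rightarrow> 'a locality \<Rightarrow> 'a set" where
  "loc_O K v = (\<Union>p\<in>v. place_O K p)"

definition loc_m :: "'a ring \<Rightarrow> 'a locality \<Rightarrow> 'a set" where
  "loc_m K v = (\<Union>p\<in>v. place_m K p)"


lemma loc_O_locality_of: "field K \<Longrightarrow> is_place K p \<Longrightarrow> loc_O K (locality_of K p) = place_O K p"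
  unfolding loc_O_def locality_of_def using place_equiv_O_m place_equiv.refl by blast

lemma loc_m_locality_of: "field K \<Longrightarrow> is_place K p \<Longrightarrow> loc_m K (locality_of K p) = place_m K p"
  unfolding loc_m_def locality_of_def using place_equiv_O_m place_equiv.refl by blast


section \<open>Topologies\<close>

definition Zar :: "'a ring \<Rightarrow> 'a locality topology" where
  "Zar K = topology_generated_by {{v \<in> localities K. x \<in> loc_O K v} | x. x \<in> carrier K}"

definition Zar_star :: "'a ring \<Rightarrow> 'a locality topology" where
  "Zar_star K = topology_generated_by {{v \<in> localities K. x \<in> loc_m K v} | x. x \<in> carrier K}"

datatype situation = Situation_m | Situation_O

fun frakB :: "situation \<Rightarrow> 'a ring \<Rightarrow> 'a locality \<Rightarrow> 'a set" where
  "frakB Situation_m = loc_m"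
| "frakB Situation_O = loc_O"

fun loc_topology :: "situation \<Rightarrow> 'a ring \<Rightarrow> 'a locality topology" where
  "loc_topology Situation_m = Zar_star"
| "loc_topology Situation_O = Zar"


section \<open>Refinement and independence\<close>

definition is_refinement :: "'a ring \<Rightarrow> 'a locality \<Rightarrow> 'a locality \<Rightarrow> bool" where
  "is_refinement K v w \<longleftrightarrow> loc_O K v \<subseteq> loc_O K w"

definition incomparable :: "'a ring \<Rightarrow> 'a locality \<Rightarrow> 'a locality \<Rightarrow> bool" where
  "incomparable K v w \<longleftrightarrow> \<not> is_refinement K v w \<and> \<not> is_refinement K w v"

text \<open>
  \<open>u = v \<or> w\<close>. Any two localities have exactly one finest common coarsening, so
  the existential quantifiers over \<open>u\<close> below just name it.
\<close>

definition finest_common_coarsening ::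
    "'a ring \<Rightarrow> 'a locality \<Rightarrow> 'a locality \<Rightarrow> 'a locality \<Rightarrow> bool" where
  "finest_common_coarsening K v w u \<longleftrightarrow>
     u \<in> localities K \<and> is_refinement K v u \<and> is_refinement K w u \<and>
     (\<forall>u'\<in>localities K. is_refinement K v u' \<and> is_refinement K w u' \<longrightarrow> is_refinement K u u')"

definition valuation_subring :: "'a ring \<Rightarrow> 'a locality \<Rightarrow> 'a ring" where
  "valuation_subring K w = K\<lparr>carrier := loc_O K w\<rparr>"

definition residue_field :: "'a ring \<Rightarrow> 'a locality \<Rightarrow> 'a set ring" where
  "residue_field K w = valuation_subring K w Quot loc_m K w"

text \<open>The locality on the residue field of \<open>w\<close> induced by a refinement \<open>v\<close> of \<open>w\<close>.\<close>

definition induced_locality :: "'a ring \<Rightarrow> 'a locality \<Rightarrow> 'a locality \<Rightarrow> 'a set locality" where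
  "induced_locality K w v =
     (THE u. u \<in> localities (residue_field K w) \<and>
        loc_O (residue_field K w) u =
          (\<lambda>x. loc_m K w +>\<^bsub>valuation_subring K w\<^esub> x) ` loc_O K v)"

text \<open>
  The finest common coarsening of two incomparable localities is a valuation, so its residue
  field is defined.
\<close>

definition strongly_incomparable :: "'a ring \<Rightarrow> 'a locality \<Rightarrow> 'a locality \<Rightarrow> bool" where
  "strongly_incomparable K v w \<longleftrightarrow>
     incomparable K v w \<and>
     (\<exists>u. finest_common_coarsening K v w u \<and> induced_locality K u v \<noteq> induced_locality K u w)"

definition t_independent :: "'a ring \<Rightarrow> 'a \<Rightarrow> 'a locality \<Rightarrow> 'a locality \<Rightarrow> bool" where
  "t_independent K t v w \<longleftrightarrow>
     (\<exists>u. finest_common_coarsening K v w u \<and> t \<in> loc_O K u - loc_m K u) \<and>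
     (v \<in> S_ord K \<and> w \<in> S_ord K \<longrightarrow> strongly_incomparable K v w)"

end

theory Submission
  imports Defs
begin

text \<open>
  Every locality is treated through its ball \<open>O\<close>, a multiplicatively closed set containing
  \<open>x\<close> or \<open>1/x\<close> for each \<open>x\<close>; then \<open>m\<close> consists of \<open>0\<close> and of all \<open>x\<close> with
  \<open>1/x \<notin> O\<close>. For \<open>v \<in> S_i\<close> and \<open>w \<in> S_j\<close>, \<open>i \<noteq> j\<close>, independence makes \<open>O_v O_w\<close> a
  valuation ring, the ring of \<open>v \<or> w\<close>, in which \<open>t\<close> is a unit. An element of this ring is a product
  \<open>a b\<close> with \<open>a \<in> O_v\<close> and \<open>b \<in> O_w\<close>, and such factorizations yield elements that are
  small at \<open>v\<close> and large at \<open>w\<close>.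

  By compactness and a combination step these pairwise separating elements merge into one that
  is small on one set of localities and large on another. For infinite \<open>S_i\<close> two elements are
  combined by the homogenization \<open>y^d f(x/y)\<close>: its size is that of \<open>max(|x|,|y|)^d\<close> up
  to a factor \<open>t\<close>, a loss which \<open>d \<ge> 2\<close> absorbs, so that it does not accumulate along the
  finite subcover. On finitely many localities, where \<open>f\<close> may have zeros, sums of suitable powers
  avoid cancellation. From a separating element \<open>x\<close> the function \<open>a_d x^d / f(x)\<close> (or
  \<open>x / (1 + x)\<close>) is close to \<open>1\<close> on one side and to \<open>0\<close> on the other, and glues two
  partial solutions. The infinite \<open>S_i\<close> are glued first, then the finite ones, and
  finally both parts; in Situation \<open>O\<close> the localities in finite \<open>S_i\<close> that coarsen
  others impose no condition of their own and are discarded beforehand.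
\<close>

section \<open>Families of balls\<close>

definition nonunits :: "'a::field set \<Rightarrow> 'a set" where
  "nonunits R = {x. x = 0 \<or> inverse x \<notin> R}"

locale unit_ball =
  fixes R :: "'a::field set"
  assumes mult: "a \<in> R \<Longrightarrow> b \<in> R \<Longrightarrow> a * b \<in> R"
    and total: "a \<in> R \<or> inverse a \<in> R"
begin

lemma zero: "0 \<in> R"
  \<comment> \<open>The convention \<open>inverse 0 = 0\<close> makes both alternatives of totality
    at 0 the same.\<close>
  using total[of 0] by simp

lemma one: "1 \<in> R"
  using total[of 1] by simp

lemma minus_one: "- 1 \<in> R"
  using total[of "- 1"] by simp

lemma uminus: "a \<in> R \<Longrightarrow> - a \<in> R"
  using mult[OF minus_one, of a] by simp

lemma power: "a \<in> R \<Longrightarrow> a ^ n \<in> R"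
  by (induction n) (auto intro: mult one)

lemma nonunits_subset: "nonunits R \<subseteq> R"
  using total zero by (auto simp: nonunits_def)

lemma nonunits_mult:
  assumes "a \<in> nonunits R" "b \<in> R"
  shows "a * b \<in> nonunits R"
proof (cases "a * b = 0")
  case False
  have "inverse (a * b) \<notin> R"
  proof
    assume "inverse (a * b) \<in> R"
    then have "inverse (a * b) * b \<in> R" using assms(2) by (rule mult)
    then have "inverse a \<in> R" using False by (simp add: field_simps)
    then show False using assms(1) False by (auto simp: nonunits_def)
  qed
  then show ?thesis by (simp add: nonunits_def)
qed (simp add: nonunits_def)

lemma one_notin_nonunits: "1 \<notin> nonunits R"
  using one by (simp add: nonunits_def)

text \<open>For nonzero \<open>a\<close>, multiplying \<open>a ^ n\<close> by \<open>n - 1\<close>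
  factors \<open>inverse a\<close> gives back \<open>a\<close>.\<close>

lemma power_inverse_mem:
  assumes "inverse a \<in> R" "a ^ n \<in> R" "n > 0"
  shows "a \<in> R"
proof (cases "a = 0")
  case False
  have "a ^ n * inverse a ^ (n - 1) \<in> R"
    using assms(1,2) by (rule mult[OF _ power, rotated])
  also have "a ^ n * inverse a ^ (n - 1) = a"
    using False assms(3) by (cases n) (simp_all add: power_inverse)
  finally show ?thesis .
qed (simp add: zero)

end

text \<open>\<open>t\<close> makes up for the failure of additive closure, as in condition (iv).
  \<open>B\<close> is chosen point by point because the final proof asks for nonunits at the points
  of finite \<open>S_i\<close> in both situations, and for \<open>frakB\<close> at the
  others.\<close>

locale ball_family =
  fixes P :: "'p set" and R B :: "'p \<Rightarrow> 'a::field set" and t :: 'a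
  assumes t: "t \<noteq> 0"
    and ball: "p \<in> P \<Longrightarrow> unit_ball (R p)"
    and add: "p \<in> P \<Longrightarrow> a \<in> R p \<Longrightarrow> b \<in> R p \<Longrightarrow> t * (a + b) \<in> R p"
    and B: "p \<in> P \<Longrightarrow> B p = R p \<or> B p = nonunits (R p)"
begin

lemmas mult = unit_ball.mult[OF ball]
  and total = unit_ball.total[OF ball]
  and zero = unit_ball.zero[OF ball]
  and one = unit_ball.one[OF ball]
  and uminus = unit_ball.uminus[OF ball]
  and power = unit_ball.power[OF ball]
  and nonunits_subset = unit_ball.nonunits_subset[OF ball]
  and nonunits_mult = unit_ball.nonunits_mult[OF ball]

lemma t_mem: "p \<in> P \<Longrightarrow> t \<in> R p"
  using add[OF _ zero one] by simp

lemma B_subset: "p \<in> P \<Longrightarrow> a \<in> B p \<Longrightarrow> a \<in> R p"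
  using B[of p] nonunits_subset by blast

lemma B_mult: "p \<in> P \<Longrightarrow> a \<in> B p \<Longrightarrow> b \<in> R p \<Longrightarrow> a * b \<in> B p"
  using B[of p] mult nonunits_mult by metis

lemma B_zero: "p \<in> P \<Longrightarrow> 0 \<in> B p"
  using B[of p] zero by (auto simp: nonunits_def)

lemma B_uminus: "p \<in> P \<Longrightarrow> a \<in> B p \<Longrightarrow> - a \<in> B p"
  using B_mult[of p a "- 1"] uminus one by simp

text \<open>Factor out the larger summand: in \<open>a + b = b * (a / b + 1)\<close> with
  \<open>a / b\<close> in the ball, the additive bound is applied to the full ball only.\<close>

lemma B_add:
  assumes p: "p \<in> P" and ab: "a \<in> B p" "b \<in> B p"
  shows "t * (a + b) \<in> B p"
proof -
  have *: "t * (a + b) \<in> B p" if "b \<in> B p" "b \<noteq> 0" "a / b \<in> R p" for a b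
  proof -
    have "b * (t * (a / b + 1)) \<in> B p"
      by (rule B_mult[OF p that(1) add[OF p that(3) one[OF p]]])
    moreover have "b * (t * (a / b + 1)) = t * (a + b)"
      using that(2) by (simp add: divide_simps)
    ultimately show ?thesis by simp
  qed
  consider "a = 0" | "b = 0" | "a \<noteq> 0" "b \<noteq> 0" "a / b \<in> R p" | "a \<noteq> 0" "b \<noteq> 0" "b / a \<in> R p"
    using total[OF p, of "a / b"] by force
  then show ?thesis
  proof cases
    case 1
    then show ?thesis using B_mult[OF p ab(2) t_mem[OF p]] by (simp add: mult.commute)
  next
    case 2
    then show ?thesis using B_mult[OF p ab(1) t_mem[OF p]] by (simp add: mult.commute)
  next
    case 3
    then show ?thesis using * ab by blast
  next
    case 4
    then show ?thesis using *[of a b] ab by (simp add: add.commute)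
  qed
qed

text \<open>
  The factor \<open>t ^ 5\<close> leaves room for the powers of \<open>t\<close> lost in the estimates below. At a
  point where \<open>B\<close> is the full ball, \<open>t\<close> may be a unit and a small element may be one, too.
\<close>

definition small :: "('p \<Rightarrow> 'a) \<Rightarrow> 'p \<Rightarrow> 'a \<Rightarrow> bool" where
  "small l p x \<longleftrightarrow> x / t ^ 5 \<in> B p \<and> l p * x / t ^ 5 \<in> B p"

lemma small_mult:
  assumes "p \<in> P" "small l p x" "a \<in> R p"
  shows "small l p (x * a)"
  using B_mult[OF assms(1) _ assms(3)] assms(2) unfolding small_def
  by (metis times_divide_eq_left mult.assoc)

lemma small_div_mem:
  assumes p: "p \<in> P" and "small l p x" "k \<le> 5"
  shows "x / t ^ k \<in> B p"
proof -
  have "x / t ^ 5 * t ^ (5 - k) \<in> B p"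
    using assms by (intro B_mult power t_mem) (auto simp: small_def)
  also have "x / t ^ 5 * t ^ (5 - k) = x / t ^ k"
    using t assms(3) by (simp add: field_simps flip: power_add)
  finally show ?thesis .
qed

lemma small_mem: "p \<in> P \<Longrightarrow> small l p x \<Longrightarrow> x \<in> R p"
  using small_div_mem[of p l x 0] B_subset by simp

text \<open>If the bound failed, \<open>(1 + x) / t\<close> would be a nonunit, like
  \<open>- x / t\<close>; then \<open>t\<close> times their sum, which is 1, would be a nonunit
  too.\<close>

lemma inverse_add_bound:
  assumes p: "p \<in> P" and "x / t \<in> nonunits (R p)"
  shows "1 + x \<noteq> 0" "t / (1 + x) \<in> R p"
proof -
  have *: "1 + x \<noteq> 0 \<and> t / (1 + x) \<in> R p"
  proof (rule ccontr)
    assume "\<not> (1 + x \<noteq> 0 \<and> t / (1 + x) \<in> R p)"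
    then have "(1 + x) / t \<in> nonunits (R p)"
      using t by (auto simp: nonunits_def)
    moreover have "- x / t \<in> nonunits (R p)"
      using nonunits_mult[OF p assms(2) uminus[OF p one[OF p]]] by simp
    \<comment> \<open>The additive bound is wanted for nonunits whatever \<open>B p\<close> is,
      hence a one-point family whose \<open>B\<close> consists of nonunits.\<close>
    ultimately interpret C: ball_family "{p}" R "\<lambda>p. nonunits (R p)" t
      using p t ball add by (intro ball_family.intro) auto
    have "t * ((1 + x) / t + (- x / t)) \<in> nonunits (R p)"
      using \<open>(1 + x) / t \<in> _\<close> \<open>- x / t \<in> _\<close> by (intro C.B_add) auto
    moreover have "t * ((1 + x) / t + (- x / t)) = 1" using t by (simp add: field_simps)
    ultimately show False using unit_ball.one_notin_nonunits[OF ball[OF p]] by simp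
  qed
  then show "1 + x \<noteq> 0" "t / (1 + x) \<in> R p" by blast+
qed

text \<open>Factor \<open>c = a * b\<close> along the product. One of \<open>1\<close> and
  \<open>inverse b\<close> brings \<open>c\<close> into \<open>R p\<close>, division by one of
  \<open>1\<close> and \<open>a\<close> brings it into \<open>R q\<close>, and the product of the
  two choices does both.\<close>

lemma pointwise_separation_weak:
  assumes pq: "p \<in> P" "q \<in> P" and c: "c \<in> R p * R q"
  obtains x where "x \<noteq> 0" "x \<in> R p" "c * x \<in> R p" "inverse x \<in> R q" "c / x \<in> R q"
proof -
  obtain a b where ab: "c = a * b" "a \<in> R p" "b \<in> R q"
    using c by (rule set_times_elim)
  obtain x where x: "x \<noteq> 0" "x \<in> R p" "c * x \<in> R p" "inverse x \<in> R q"
  proof (cases "b \<in> R p")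
    case True
    then have "c \<in> R p" using ab pq mult by blast
    with that[of 1] show ?thesis using one pq by simp
  next
    case False
    then have "b \<noteq> 0" using zero pq by auto
    with that[of "inverse b"] ab pq False total[of p b] show ?thesis by (simp add: mult.assoc)
  qed
  obtain y where y: "y \<noteq> 0" "y \<in> R p" "c / y \<in> R q" "inverse y \<in> R q"
  proof (cases "a \<in> R q")
    case True
    then have "c \<in> R q" using ab pq mult by blast
    with that[of 1] show ?thesis using one pq by simp
  next
    case False
    then have "a \<noteq> 0" using zero pq by auto
    with that[of a] ab pq False total[of q a] show ?thesis by simp
  qed
  have "c * (x * y) \<in> R p" "c / (x * y) \<in> R q"
    using mult[OF pq(1) x(3) y(2)] mult[OF pq(2) y(3) x(4)]
    by (simp_all add: field_simps)
  with that[of "x * y"] x y mult[OF pq(1) x(2) y(2)] mult[OF pq(2) x(4) y(4)]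
  show ?thesis by simp
qed

text \<open>Three weak separations absorb \<open>1 / t ^ 5\<close>, \<open>l p / t ^ 5\<close> and
  \<open>l q / t ^ 5\<close>; two further factors \<open>u\<close> and \<open>v\<close> push the
  result into \<open>B\<close> where that consists of nonunits.\<close>

lemma pointwise_separation:
  assumes pq: "p \<in> P" "q \<in> P"
    and M: "inverse t \<in> R p * R q" "l p \<in> R p * R q" "l q \<in> R p * R q"
    and sp: "B p = R p \<or> \<not> R q \<subseteq> R p" and sq: "B q = R q \<or> \<not> R p \<subseteq> R q"
  obtains x where "x \<noteq> 0" "small l p x" "small l q (inverse x)"
proof -
  have M_mult: "a * b \<in> R p * R q" if "a \<in> R p * R q" "b \<in> R p * R q" for a b
    using that mult pq unfolding set_times_def
    by (smt (verit) mem_Collect_eq mult.assoc mult.left_commute)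
  have "1 \<in> R p * R q" using set_times_intro[OF one one] pq by force
  then have T: "inverse t ^ n \<in> R p * R q" for n
    by (induction n) (auto intro: M_mult M)
  \<comment> \<open>Here noninclusion enters: an element of \<open>R q\<close> outside
    \<open>R p\<close> has a nonunit of \<open>R p\<close> as its inverse. The choice of
    \<open>v\<close> is symmetric.\<close>
  obtain u where u: "u \<noteq> 0" "u \<in> B p" "inverse u \<in> R q"
  proof (cases "B p = R p")
    case True
    then show ?thesis using that[of 1] one pq by simp
  next
    case False
    then obtain b where b: "b \<in> R q" "b \<notin> R p" using sp by blast
    have "b \<noteq> 0" using b zero pq by auto
    moreover have "inverse b \<in> nonunits (R p)" using b by (simp add: nonunits_def)
    ultimately show ?thesis using that[of "inverse b"] False B[OF pq(1)] b by simp
  qed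
  obtain v where v: "v \<noteq> 0" "v \<in> R p" "inverse v \<in> B q"
  proof (cases "B q = R q")
    case True
    then show ?thesis using that[of 1] one pq by simp
  next
    case False
    then obtain a where a: "a \<in> R p" "a \<notin> R q" using sq by blast
    have "a \<noteq> 0" using a zero pq by auto
    moreover have "inverse a \<in> nonunits (R q)" using a by (simp add: nonunits_def)
    ultimately show ?thesis using that[of a] False B[OF pq(2)] a by simp
  qed
  let ?T = "inverse t ^ 5"
  obtain x where x: "x \<noteq> 0" "x \<in> R p" "?T * x \<in> R p" "inverse x \<in> R q" "?T / x \<in> R q"
    using pointwise_separation_weak[OF pq T] .
  obtain y where y: "y \<noteq> 0" "y \<in> R p" "(l p * ?T) * y \<in> R p" "inverse y \<in> R q"
    using pointwise_separation_weak[OF pq M_mult[OF M(2) T]] .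
  obtain z where z: "z \<noteq> 0" "z \<in> R p" "inverse z \<in> R q" "(l q * ?T) / z \<in> R q"
    using pointwise_separation_weak[OF pq M_mult[OF M(3) T]] .
  define w where "w = u * v * x * y * z"
  have "u * (v * (?T * x) * y * z) \<in> B p" "u * (v * x * ((l p * ?T) * y) * z) \<in> B p"
    using pq u v x y z by (auto intro!: B_mult mult)
  moreover have "inverse v * (inverse u * (?T / x) * inverse y * inverse z) \<in> B q"
    "inverse v * (inverse u * inverse x * inverse y * ((l q * ?T) / z)) \<in> B q"
    using pq u v x y z by (auto intro!: B_mult mult simp del: times_divide_eq_right)
  moreover have "w \<noteq> 0" using u v x y z by (simp add: w_def)
  ultimately show ?thesis
    using that[of w] by (simp add: small_def w_def field_simps)
qed

end

section \<open>Compactness\<close>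

text \<open>Compactness of \<open>A\<close> for covers by the sets of all \<open>p\<close> with
  \<open>Pr p x\<close>. No topology is mentioned, so finite sets, compact sets and finite unions of
  both are treated alike.\<close>

definition finite_subcover :: "'p set \<Rightarrow> ('p \<Rightarrow> 'b \<Rightarrow> bool) \<Rightarrow> bool" where
  "finite_subcover A Pr \<longleftrightarrow>
     (\<forall>Q. (\<forall>p\<in>A. \<exists>x\<in>Q. Pr p x) \<longrightarrow> (\<exists>Q'. finite Q' \<and> Q' \<subseteq> Q \<and> (\<forall>p\<in>A. \<exists>x\<in>Q'. Pr p x)))"

lemma finite_subcoverD:
  assumes "finite_subcover A Pr" "\<And>p. p \<in> A \<Longrightarrow> \<exists>x\<in>Q. Pr p x"
  obtains Q' where "finite Q'" "Q' \<subseteq> Q" "\<forall>p\<in>A. \<exists>x\<in>Q'. Pr p x"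
proof -
  have "\<exists>Q'. finite Q' \<and> Q' \<subseteq> Q \<and> (\<forall>p\<in>A. \<exists>x\<in>Q'. Pr p x)"
    using assms(1)[unfolded finite_subcover_def, THEN spec, of Q] assms(2) by simp
  then show ?thesis using that by auto
qed

lemma finite_subcover_finite:
  assumes "finite A"
  shows "finite_subcover A Pr"
  unfolding finite_subcover_def
proof (intro allI impI)
  fix Q assume "\<forall>p\<in>A. \<exists>x\<in>Q. Pr p x"
  then obtain g where "\<forall>p\<in>A. g p \<in> Q \<and> Pr p (g p)" by metis
  with assms show "\<exists>Q'. finite Q' \<and> Q' \<subseteq> Q \<and> (\<forall>p\<in>A. \<exists>x\<in>Q'. Pr p x)"
    by (intro exI[of _ "g ` A"]) auto
qed

lemma finite_subcover_UN:
  assumes "finite J" "\<And>j. j \<in> J \<Longrightarrow> finite_subcover (A j) Pr"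
  shows "finite_subcover (\<Union>j\<in>J. A j) Pr"
  unfolding finite_subcover_def
proof (intro allI impI)
  fix Q assume Q: "\<forall>p\<in>(\<Union>j\<in>J. A j). \<exists>x\<in>Q. Pr p x"
  have "\<exists>Q'. finite Q' \<and> Q' \<subseteq> Q \<and> (\<forall>p\<in>A j. \<exists>x\<in>Q'. Pr p x)" if j: "j \<in> J" for j
  proof -
    have "\<exists>x\<in>Q. Pr p x" if "p \<in> A j" for p
      using Q j that by auto
    from finite_subcoverD[OF assms(2)[OF j] this] show ?thesis by metis
  qed
  then obtain Q' where Q': "\<And>j. j \<in> J \<Longrightarrow> finite (Q' j)" "\<And>j. j \<in> J \<Longrightarrow> Q' j \<subseteq> Q"
    "\<And>j. j \<in> J \<Longrightarrow> \<forall>p\<in>A j. \<exists>x\<in>Q' j. Pr p x"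
    by metis
  show "\<exists>Q'. finite Q' \<and> Q' \<subseteq> Q \<and> (\<forall>p\<in>(\<Union>j\<in>J. A j). \<exists>x\<in>Q'. Pr p x)"
  proof (intro exI conjI ballI)
    show "finite (\<Union>j\<in>J. Q' j)" "(\<Union>j\<in>J. Q' j) \<subseteq> Q" using assms(1) Q' by auto
    fix p assume "p \<in> (\<Union>j\<in>J. A j)"
    then obtain j where "j \<in> J" "p \<in> A j" by blast
    with Q'(3)[of j] show "\<exists>x\<in>\<Union> (Q' ` J). Pr p x" by blast
  qed
qed

text \<open>By \<open>join\<close> the witnesses are directed, so those of a finite subcover merge
  into one by induction; \<open>Q \<noteq> {}\<close> starts the induction.\<close>

lemma finite_subcover_common_witness:
  assumes A: "finite_subcover A Pr" and Q: "\<And>p. p \<in> A \<Longrightarrow> \<exists>x\<in>Q. Pr p x" "Q \<noteq> {}"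
    and join: "\<And>x y. x \<in> Q \<Longrightarrow> y \<in> Q \<Longrightarrow> \<exists>w\<in>Q. \<forall>p\<in>A. Pr p x \<or> Pr p y \<longrightarrow> Pr p w"
  shows "\<exists>w\<in>Q. \<forall>p\<in>A. Pr p w"
proof -
  obtain Q' where Q': "finite Q'" "Q' \<subseteq> Q" "\<forall>p\<in>A. \<exists>x\<in>Q'. Pr p x"
    by (rule finite_subcoverD[OF A Q(1)])
  from Q'(1,2) have "\<exists>w\<in>Q. \<forall>p\<in>A. \<forall>x\<in>Q'. Pr p x \<longrightarrow> Pr p w"
  proof (induction Q' rule: finite_induct)
    case empty
    then show ?case using Q(2) by blast
  next
    case (insert x Q')
    then obtain w where w: "w \<in> Q" "\<forall>p\<in>A. \<forall>x\<in>Q'. Pr p x \<longrightarrow> Pr p w" by blast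
    obtain w' where "w' \<in> Q" "\<forall>p\<in>A. Pr p x \<or> Pr p w \<longrightarrow> Pr p w'"
      using join[of x w] insert.prems w(1) by blast
    with w show ?case by (intro bexI[of _ w']) auto
  qed
  then show ?thesis using Q'(3) by blast
qed

section \<open>Merging two elements, global separation, bump functions\<close>

context ball_family
begin

lemma small_add: "p \<in> P \<Longrightarrow> small l p x \<Longrightarrow> small l p y \<Longrightarrow> small l p (t * (x + y))"
  using B_add[of p "x / t ^ 5" "y / t ^ 5"] B_add[of p "l p * x / t ^ 5" "l p * y / t ^ 5"]
  by (simp add: small_def add_divide_distrib distrib_left mult_ac)

text \<open>\<open>w\<close> acts as a maximum of \<open>x\<close> and \<open>y\<close>: large at
  points of \<open>A\<close> where one of them is, small wherever both are. The second clause speaks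
  of all of \<open>P\<close>, because what was achieved at points outside \<open>A\<close> has to
  survive the merging.\<close>

definition combinable :: "'p set \<Rightarrow> ('p \<Rightarrow> 'a) \<Rightarrow> bool" where
  "combinable A l \<longleftrightarrow>
     (\<forall>x y. x \<noteq> 0 \<longrightarrow> y \<noteq> 0 \<longrightarrow> (\<exists>w. w \<noteq> 0 \<and>
        (\<forall>p\<in>A. small l p (inverse x) \<or> small l p (inverse y) \<longrightarrow> small l p (inverse w)) \<and>
        (\<forall>p\<in>P. small l p x \<and> small l p y \<longrightarrow> small l p w)))"

text \<open>Passing to inverses turns the maximum into a minimum, the form in which small elements
  are merged.\<close>

lemma combinableD:
  assumes "combinable A l" "x \<noteq> 0" "y \<noteq> 0"
  obtains w where "w \<noteq> 0" "\<And>p. p \<in> A \<Longrightarrow> small l p x \<or> small l p y \<Longrightarrow> small l p w"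
    "\<And>p. p \<in> P \<Longrightarrow> small l p (inverse x) \<Longrightarrow> small l p (inverse y) \<Longrightarrow> small l p (inverse w)"
proof -
  obtain w where w: "w \<noteq> 0"
    "\<forall>p\<in>A. small l p (inverse (inverse x)) \<or> small l p (inverse (inverse y)) \<longrightarrow> small l p (inverse w)"
    "\<forall>p\<in>P. small l p (inverse x) \<and> small l p (inverse y) \<longrightarrow> small l p w"
    using assms unfolding combinable_def by (metis nonzero_imp_inverse_nonzero)
  show ?thesis by (rule that[of "inverse w"]) (use w in auto)
qed

text \<open>In \<open>x + y = x * (1 + y / x)\<close> the quotient \<open>y / x\<close> stays a
  nonunit after division by \<open>t\<close>, so \<open>inverse_add_bound\<close> rules out
  cancellation.\<close>

lemma dominant_power:
  assumes p: "p \<in> P" and nz: "x \<noteq> 0" and r: "y / (t * x) \<in> nonunits (R p)"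
  shows "x + y \<noteq> 0" "t * x / (x + y) \<in> R p" "t * y / (x + y) \<in> R p"
proof -
  have 1: "y / x / t \<in> nonunits (R p)" using r by (simp add: mult.commute)
  note b = inverse_add_bound[OF p 1]
  have eq: "x + y = x * (1 + y / x)" using nz by (simp add: field_simps)
  show "x + y \<noteq> 0" using b nz unfolding eq by simp
  show 2: "t * x / (x + y) \<in> R p" using b nz unfolding eq by simp
  have "y / x = y / (t * x) * t" using t by simp
  then have "y / x \<in> R p" using mult[OF p _ t_mem[OF p]] r nonunits_subset[OF p] by (metis subsetD)
  from mult[OF p 2 this] show "t * y / (x + y) \<in> R p" using nz by simp
qed

text \<open>Of the \<open>n \<ge> 2\<close> factors \<open>inverse x\<close>, one carries the
  smallness and another absorbs the factor \<open>1 / t\<close>.\<close>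

lemma small_inverse_power:
  assumes p: "p \<in> P" and s: "small l p (inverse x)" and x: "x \<noteq> 0" and "n \<ge> 2"
    and w: "t * x ^ n / w \<in> R p"
  shows "small l p (inverse w)"
proof -
  have 1: "inverse x / t \<in> R p"
    using small_div_mem[OF p s, of 1] B_subset[OF p] by simp
  have "small l p (inverse x * (inverse x ^ (n - 2) * (inverse x / t) * (t * x ^ n / w)))"
    by (intro small_mult mult power p s w 1 small_mem[OF p s])
  moreover have "inverse x * (inverse x ^ (n - 2) * (inverse x / t) * (t * x ^ n / w)) = inverse w"
  proof -
    have "x ^ n = x ^ (n - 2) * x ^ 2"
      using \<open>n \<ge> 2\<close> by (metis le_add_diff_inverse2 power_add)
    then show ?thesis using x t by (simp add: field_simps power2_eq_square)
  qed
  ultimately show ?thesis by simp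
qed

lemma small_power_div:
  assumes p: "p \<in> P" and s: "small l p x" and "n \<ge> 2"
  shows "small l p (x ^ n / t)"
proof -
  have "x / t \<in> R p" using small_div_mem[OF p s, of 1] B_subset[OF p] by simp
  then have "small l p (x * (x / t * x ^ (n - 2)))"
    by (intro small_mult mult power p s small_mem[OF p s])
  moreover have "x * (x / t * x ^ (n - 2)) = x ^ n / t"
    using \<open>n \<ge> 2\<close> by (auto simp: power2_eq_square power_add dest!: le_Suc_ex)
  ultimately show ?thesis by (simp only:)
qed

text \<open>
  For each point at most one exponent \<open>b\<close> makes \<open>y ^ b\<close> comparable to \<open>x ^ N\<close>, so some
  exponent \<open>b \<le> N\<close> avoids cancellation in \<open>x ^ N + y ^ b\<close> at all the finitely many points.
\<close>

lemma combinable_finite: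
  assumes fin: "finite A" and A: "A \<subseteq> P" and BA: "\<And>p. p \<in> A \<Longrightarrow> B p = nonunits (R p)"
  shows "combinable A l"
  unfolding combinable_def
proof (intro allI impI)
  fix x y :: 'a assume nz: "x \<noteq> 0" "y \<noteq> 0"
  show "\<exists>w. w \<noteq> 0 \<and>
        (\<forall>p\<in>A. small l p (inverse x) \<or> small l p (inverse y) \<longrightarrow> small l p (inverse w)) \<and>
        (\<forall>p\<in>P. small l p x \<and> small l p y \<longrightarrow> small l p w)"
  \<comment> \<open>A point where \<open>x\<close> or \<open>y\<close> is large shows that the sum
    constructed below is nonzero; without such a point \<open>x\<close> itself serves.\<close>
  proof (cases "\<exists>p\<in>A. small l p (inverse x) \<or> small l p (inverse y)")
    case False
    with nz show ?thesis by blast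
  next
    case True
    \<comment> \<open>\<open>{2..N}\<close> has \<open>card A + 1\<close> elements, one more than
      there can be bad exponents; it starts at 2 so that a factor \<open>1 / t\<close> can be
      absorbed.\<close>
    define N where "N = card A + 2"
    \<comment> \<open>The exponent is bad if neither summand dominates the other. Requiring
      \<open>y\<close> to be large keeps its powers apart, which leaves at most one bad exponent per
      point.\<close>
    define bad where "bad p = {b. inverse (t ^ 2 * y) \<in> nonunits (R p) \<and>
      y ^ b / (t * x ^ N) \<notin> nonunits (R p) \<and> x ^ N / (t * y ^ b) \<notin> nonunits (R p)}" for p
    \<comment> \<open>Two bad exponents would put \<open>t ^ 2 * y ^ (c - b)\<close> into the ball;
      removing powers of \<open>y\<close> leaves \<open>t ^ 2 * y\<close>, against the largeness of
      \<open>y\<close>.\<close>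
    have less: False if p: "p \<in> A" and b: "b \<in> bad p" "c \<in> bad p" "b < c" for p b c
    proof -
      have pP: "p \<in> P" using p A by blast
      have y: "inverse (t ^ 2 * y) \<in> nonunits (R p)" using b by (simp add: bad_def)
      have "x ^ N / (t * y ^ c) \<notin> nonunits (R p)" "y ^ b / (t * x ^ N) \<notin> nonunits (R p)"
        using b by (simp_all add: bad_def)
      then have "t * y ^ c / x ^ N \<in> R p" "t * x ^ N / y ^ b \<in> R p"
        by (simp_all add: nonunits_def)
      then have "(t * y ^ c / x ^ N) * (t * x ^ N / y ^ b) \<in> R p" by (rule mult[OF pP])
      also have "(t * y ^ c / x ^ N) * (t * x ^ N / y ^ b) = t ^ 2 * y * y ^ (c - b - 1)"
        using nz \<open>b < c\<close> by (auto simp: power2_eq_square power_add dest!: less_imp_Suc_add)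
      finally have "t ^ 2 * y * y ^ (c - b - 1) \<in> R p" .
      moreover have "inverse y = inverse (t ^ 2 * y) * t ^ 2" using t by (simp add: field_simps)
      then have "inverse y \<in> R p"
        using y nonunits_subset[OF pP] mult[OF pP _ power[OF pP t_mem[OF pP]]] by (metis subsetD)
      ultimately have "t ^ 2 * y * y ^ (c - b - 1) * inverse y ^ (c - b - 1) \<in> R p"
        by (rule mult[OF pP _ power[OF pP]])
      then have "t ^ 2 * y \<in> R p" using nz by (simp add: field_simps)
      with y nz t show False by (simp add: nonunits_def)
    qed
    have bad: "finite (bad p) \<and> card (bad p) \<le> 1" if "p \<in> A" for p
    proof -
      have "b = c" if "b \<in> bad p" "c \<in> bad p" for b c
        using less[OF \<open>p \<in> A\<close> that] less[OF \<open>p \<in> A\<close> that(2,1)]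
        by (cases b c rule: linorder_cases) auto
      then have "bad p = {} \<or> (\<exists>b. bad p = {b})" by blast
      then show ?thesis by auto
    qed
    have "card (\<Union>p\<in>A. bad p) \<le> card A * 1"
      using card_UN_le[OF fin, of bad] sum_bounded_above[of A "\<lambda>p. card (bad p)" 1] bad
      by simp
    then have "card (\<Union>p\<in>A. bad p) < card {2..N}" by (simp add: N_def)
    moreover have "finite (\<Union>p\<in>A. bad p)" using fin bad by blast
    ultimately have "\<not> {2..N} \<subseteq> (\<Union>p\<in>A. bad p)"
      using card_mono leD by blast
    then obtain b where b': "b \<in> {2..N}" "b \<notin> (\<Union>p\<in>A. bad p)" by blast
    then have b: "2 \<le> b" "b \<le> N" "\<And>p. p \<in> A \<Longrightarrow> b \<notin> bad p" by auto
    define w where "w = x ^ N + y ^ b"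
    have N: "N \<ge> 2" by (simp add: N_def)
    have A_bound: "w \<noteq> 0 \<and> t * x ^ N / w \<in> R p \<and> t * y ^ b / w \<in> R p"
      if p: "p \<in> A" and s: "small l p (inverse x) \<or> small l p (inverse y)" for p
    proof -
      have pP: "p \<in> P" using p A by blast
      have "y ^ b / (t * x ^ N) \<in> nonunits (R p) \<or> x ^ N / (t * y ^ b) \<in> nonunits (R p)"
      proof (cases "inverse (t ^ 2 * y) \<in> nonunits (R p)")
        case True
        then show ?thesis using b(3)[OF p] by (auto simp: bad_def)
      next
        \<comment> \<open>Here \<open>y\<close> is not large, so \<open>x\<close> is, and
          \<open>x ^ N\<close> dominates. The exponent \<open>5 * N - (2 * b + 1)\<close> is not
          truncated, because \<open>b \<le> N\<close> and \<open>N \<ge> 2\<close>.\<close>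
        case False
        then have y: "t ^ 2 * y \<in> R p" by (simp add: nonunits_def)
        have "inverse (t ^ 2 * y) = inverse y / t ^ 2" by (simp add: field_simps)
        then have "\<not> small l p (inverse y)"
          using small_div_mem[OF pP, of l "inverse y" 2] False BA[OF p] by auto
        then have "inverse x / t ^ 5 \<in> nonunits (R p)" using s BA[OF p] by (auto simp: small_def)
        moreover have "inverse x / t ^ 5 \<in> R p" using calculation nonunits_subset[OF pP] by blast
        ultimately have "inverse x / t ^ 5 *
            ((inverse x / t ^ 5) ^ (N - 1) * (t ^ 2 * y) ^ b * t ^ (5 * N - (2 * b + 1))) \<in> nonunits (R p)"
          by (intro nonunits_mult mult power y t_mem pP)
        moreover have "inverse x / t ^ 5 *
            ((inverse x / t ^ 5) ^ (N - 1) * (t ^ 2 * y) ^ b * t ^ (5 * N - (2 * b + 1)))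
            = y ^ b / (t * x ^ N)"
        proof -
          have 1: "inverse x / t ^ 5 * (inverse x / t ^ 5) ^ (N - 1) = inverse (x ^ N * t ^ (5 * N))"
          proof -
            have "inverse x / t ^ 5 * (inverse x / t ^ 5) ^ (N - 1) = (inverse x / t ^ 5) ^ N"
              using N by (simp only: power_eq_if[of _ N] split: if_splits) simp
            also have "\<dots> = inverse (x ^ N * t ^ (5 * N))"
              by (simp add: power_mult power_mult_distrib power_inverse divide_inverse)
            finally show ?thesis .
          qed
          have 2: "t ^ (2 * b) * t ^ (5 * N - (2 * b + 1)) * t = t ^ (5 * N)"
            using N b(2) by (simp flip: power_add power_Suc2)
          have "inverse x / t ^ 5 *
            ((inverse x / t ^ 5) ^ (N - 1) * (t ^ 2 * y) ^ b * t ^ (5 * N - (2 * b + 1)))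
            = inverse (x ^ N * t ^ (5 * N)) * (y ^ b * (t ^ (2 * b) * t ^ (5 * N - (2 * b + 1)) * t) / t)"
          proof -
            have "(t ^ 2 * y) ^ b = y ^ b * t ^ (2 * b)"
              by (simp add: power_mult_distrib power_mult)
            then show ?thesis unfolding mult.assoc[symmetric] 1 using t by simp
          qed
          also have "\<dots> = y ^ b / (t * x ^ N)" unfolding 2 using t nz by (simp add: field_simps)
          finally show ?thesis .
        qed
        ultimately show ?thesis by simp
      qed
      then show ?thesis
        using dominant_power[OF pP, of "x ^ N" "y ^ b"] dominant_power[OF pP, of "y ^ b" "x ^ N"] nz
        by (auto simp: w_def add.commute)
    qed
    have "w \<noteq> 0" using True A_bound by blast
    moreover have "small l p (inverse w)"
      if "p \<in> A" "small l p (inverse x) \<or> small l p (inverse y)" for p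
      using A_bound[OF that] that A small_inverse_power[of p l x N w] small_inverse_power[of p l y b w]
        N b(1) nz by blast
    moreover have "small l p w" if p: "p \<in> P" and "small l p x" "small l p y" for p
    proof -
      have "small l p (t * (x ^ N / t + y ^ b / t))"
        by (intro small_add small_power_div that N b(1))
      moreover have "t * (x ^ N / t + y ^ b / t) = w" using t by (simp add: w_def distrib_left)
      ultimately show ?thesis by (simp only:)
    qed
    ultimately show ?thesis by blast
  qed
qed


text \<open>Compactness is used twice. For fixed \<open>q\<close>, elements small at single points
  of \<open>A\<close> are merged while staying large at \<open>q\<close>; then, in terms of
  inverses, the results are merged over \<open>G\<close> while staying small on all of
  \<open>A\<close>.\<close>

lemma separation:
  assumes AG: "A \<subseteq> P" "G \<subseteq> P" "A \<noteq> {}" "G \<noteq> {}"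
    and cover: "finite_subcover A (small l)" "finite_subcover G (small l)"
    and comb: "combinable A l" "combinable G l"
    and pair: "\<And>p q. p \<in> A \<Longrightarrow> q \<in> G \<Longrightarrow> \<exists>x. x \<noteq> 0 \<and> small l p x \<and> small l q (inverse x)"
  obtains x where "x \<noteq> 0" "\<And>p. p \<in> A \<Longrightarrow> small l p x" "\<And>q. q \<in> G \<Longrightarrow> small l q (inverse x)"
proof -
  have one_point: "\<exists>x. x \<noteq> 0 \<and> (\<forall>p\<in>A. small l p x) \<and> small l q (inverse x)" if q: "q \<in> G" for q
  proof -
    have "\<exists>w\<in>{x. x \<noteq> 0 \<and> small l q (inverse x)}. \<forall>p\<in>A. small l p w"
    proof (rule finite_subcover_common_witness[OF cover(1)])
      show "\<exists>x\<in>{x. x \<noteq> 0 \<and> small l q (inverse x)}. small l p x" if "p \<in> A" for p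
        using pair[OF that q] by blast
      then show "{x. x \<noteq> 0 \<and> small l q (inverse x)} \<noteq> {}" using AG(3) by blast
    next
      fix x y assume "x \<in> {x. x \<noteq> 0 \<and> small l q (inverse x)}" "y \<in> {x. x \<noteq> 0 \<and> small l q (inverse x)}"
      then show "\<exists>w\<in>{x. x \<noteq> 0 \<and> small l q (inverse x)}. \<forall>p\<in>A. small l p x \<or> small l p y \<longrightarrow> small l p w"
        using combinableD[OF comb(1), of x y] q AG(2) by (smt (verit) mem_Collect_eq subsetD)
    qed
    then show ?thesis by blast
  qed
  let ?Q = "{x. x \<noteq> 0 \<and> (\<forall>p\<in>A. small l p (inverse x))}"
  have "\<exists>w\<in>?Q. \<forall>q\<in>G. small l q w"
  proof (rule finite_subcover_common_witness[OF cover(2)])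
    show "\<exists>x\<in>?Q. small l q x" if "q \<in> G" for q
    proof -
      obtain x where "x \<noteq> 0" "\<forall>p\<in>A. small l p x" "small l q (inverse x)"
        using one_point[OF \<open>q \<in> G\<close>] by blast
      then show ?thesis by (intro bexI[of _ "inverse x"]) auto
    qed
    then show "?Q \<noteq> {}" using AG(4) by blast
  next
    fix x y assume "x \<in> ?Q" "y \<in> ?Q"
    then show "\<exists>w\<in>?Q. \<forall>q\<in>G. small l q x \<or> small l q y \<longrightarrow> small l q w"
      using combinableD[OF comb(2), of x y] AG(1) by (smt (verit) mem_Collect_eq subsetD)
  qed
  then obtain w where "w \<in> ?Q" "\<forall>q\<in>G. small l q w" by blast
  then show ?thesis using that[of "inverse w"] by simp
qed

text \<open>\<open>e\<close> plays the part of an indicator function of \<open>G\<close>, with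
  errors measured by the weight \<open>l\<close>; it has to be produced from any separating
  element.\<close>

definition bumpable :: "'p set \<Rightarrow> 'p set \<Rightarrow> bool" where
  "bumpable A G \<longleftrightarrow>
     (\<forall>l x. x \<noteq> 0 \<longrightarrow> (\<forall>p\<in>A. small l p x) \<longrightarrow> (\<forall>q\<in>G. small l q (inverse x)) \<longrightarrow>
        (\<exists>e. (\<forall>p\<in>A. l p * e \<in> B p) \<and> (\<forall>q\<in>G. l q * (1 - e) \<in> B q)))"

text \<open>With \<open>e = x / (1 + x)\<close>, the difference \<open>1 - e\<close> is the same
  expression in \<open>inverse x\<close>, so one estimate settles both sides.\<close>

lemma bumpable_nonunits:
  assumes AG: "A \<subseteq> P" "G \<subseteq> P" and B: "\<And>p. p \<in> A \<union> G \<Longrightarrow> B p = nonunits (R p)"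
  shows "bumpable A G"
  unfolding bumpable_def
proof (intro allI impI)
  fix l x assume x: "x \<noteq> 0" and A: "\<forall>p\<in>A. small l p x" and G: "\<forall>q\<in>G. small l q (inverse x)"
  have *: "1 + y \<noteq> 0 \<and> l p * (y / (1 + y)) \<in> B p" if p: "p \<in> P" "p \<in> A \<union> G" and s: "small l p y" for y p
  proof -
    have "y / t \<in> nonunits (R p)" using small_div_mem[OF p(1) s, of 1] B[OF p(2)] by simp
    note b = inverse_add_bound[OF p(1) this]
    have "(l p * y / t ^ 5) * (t ^ 4 * (t / (1 + y))) \<in> B p"
      using s by (intro B_mult mult power t_mem b p(1)) (auto simp: small_def)
    moreover have "(l p * y / t ^ 5) * (t ^ 4 * (t / (1 + y))) = l p * (y / (1 + y))"
      using t by (simp flip: power_Suc2)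
    ultimately show ?thesis using b by simp
  qed
  have "l p * (x / (1 + x)) \<in> B p" if "p \<in> A" for p
    using * that A AG by blast
  moreover have "l q * (1 - x / (1 + x)) \<in> B q" if q: "q \<in> G" for q
  proof -
    have 1: "1 + inverse x \<noteq> 0" and 2: "l q * (inverse x / (1 + inverse x)) \<in> B q"
      using *[of q "inverse x"] q G AG by blast+
    have "1 + x = x * (1 + inverse x)" using x by (simp add: field_simps)
    then have "1 + x \<noteq> 0" using 1 x by simp
    then have "1 - x / (1 + x) = inverse x / (1 + inverse x)"
      using x 1 by (simp add: divide_simps)
    then show ?thesis using 2 by simp
  qed
  ultimately show "\<exists>e. (\<forall>p\<in>A. l p * e \<in> B p) \<and> (\<forall>q\<in>G. l q * (1 - e) \<in> B q)" by blast
qed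

end

section \<open>Combination by a polynomial\<close>

locale polynomial_ball_family = ball_family P R B t
  for P :: "'p set" and R B :: "'p \<Rightarrow> 'a::field set" and t :: 'a +
  fixes f :: "'a poly" and d :: nat
  assumes d: "d \<ge> 2"
    and poly_mem: "p \<in> P \<Longrightarrow> y \<in> R p \<Longrightarrow> poly f y \<in> R p"
    and poly_outside: "p \<in> P \<Longrightarrow> y \<notin> R p \<Longrightarrow>
      poly f y \<noteq> 0 \<and> poly f y / y ^ d \<in> R p \<and> t * y ^ d / poly f y \<in> R p"
    and poly_lead: "p \<in> P \<Longrightarrow> y \<notin> R p \<Longrightarrow>
      (poly f y - Polynomial.coeff f d * y ^ d) / y ^ (d - 1) \<in> R p"
begin

text \<open>Condition (ii), with lying outside \<open>t * m\<close> written as a bound on the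
  inverse. It is kept out of the locale because it is available only at points of infinite
  \<open>S_i\<close>.\<close>

definition regular :: "'p \<Rightarrow> bool" where
  "regular p \<longleftrightarrow> (\<forall>y\<in>R p. poly f y \<noteq> 0 \<and> t / poly f y \<in> R p)"

definition homog :: "'a \<Rightarrow> 'a \<Rightarrow> 'a" where
  "homog x y = y ^ d * poly f (x / y)"

text \<open>\<open>m\<close> is the larger of \<open>x\<close> and \<open>y\<close> at
  \<open>p\<close>. If it is \<open>y\<close>, the value of \<open>f\<close> is taken inside the
  ball; otherwise \<open>poly_outside\<close> compares it with \<open>(x / y) ^ d\<close>.\<close>

lemma homog_size:
  assumes p: "p \<in> P" and nz: "x \<noteq> 0" "y \<noteq> 0"
  obtains m where "m = x \<or> m = y" "x / m \<in> R p" "y / m \<in> R p" "homog x y / m ^ d \<in> R p"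
    "regular p \<Longrightarrow> homog x y \<noteq> 0 \<and> t * m ^ d / homog x y \<in> R p"
proof (cases "x / y \<in> R p")
  case True
  show ?thesis
    using that[of y] True nz poly_mem[OF p True] one[OF p] by (auto simp: homog_def regular_def)
next
  case False
  then have 1: "y / x \<in> R p" using total[OF p, of "x / y"] by simp
  note o = poly_outside[OF p False]
  have "homog x y / x ^ d = poly f (x / y) / (x / y) ^ d"
    "t * x ^ d / homog x y = t * (x / y) ^ d / poly f (x / y)" "homog x y \<noteq> 0"
    using nz o by (simp_all add: homog_def field_simps)
  with that[of x] 1 o nz one[OF p] show ?thesis by auto
qed

lemma combinable_regular:
  assumes A: "A \<subseteq> P" and reg: "\<And>p. p \<in> A \<Longrightarrow> regular p"
  shows "combinable A l"
  unfolding combinable_def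
proof (intro allI impI)
  fix x y :: 'a assume nz: "x \<noteq> 0" "y \<noteq> 0"
  let ?w = "homog x y"
  show "\<exists>w. w \<noteq> 0 \<and>
        (\<forall>p\<in>A. small l p (inverse x) \<or> small l p (inverse y) \<longrightarrow> small l p (inverse w)) \<and>
        (\<forall>p\<in>P. small l p x \<and> small l p y \<longrightarrow> small l p w)"
  proof (cases "A = {}")
    case True
    with nz show ?thesis by blast
  next
    case False
    then obtain p0 where p0: "p0 \<in> A" by blast
    \<comment> \<open>Being nonzero does not depend on the point, so a single regular point
      suffices.\<close>
    then have "?w \<noteq> 0" using homog_size[of p0 x y] reg A nz by blast
    moreover have "small l p (inverse ?w)"
      if p: "p \<in> A" "small l p (inverse x) \<or> small l p (inverse y)" for p
    proof -
      have pP: "p \<in> P" using p A by blast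
      obtain m where m: "m = x \<or> m = y" "x / m \<in> R p" "y / m \<in> R p" "t * m ^ d / ?w \<in> R p"
        using homog_size[OF pP nz] reg[OF p(1)] by metis
      have "small l p (inverse m)"
        using p(2) small_mult[OF pP _ m(2), of l "inverse x"] small_mult[OF pP _ m(3), of l "inverse y"] nz
        by (auto simp: field_simps)
      with small_inverse_power[OF pP _ _ d m(4)] m(1) nz show ?thesis by blast
    qed
    moreover have "small l p ?w" if p: "p \<in> P" "small l p x" "small l p y" for p
    proof -
      obtain m where m: "m = x \<or> m = y" "?w / m ^ d \<in> R p"
        using homog_size[OF p(1) nz] by metis
      have s: "small l p m" using m p by blast
      then have "small l p (m * (m ^ (d - 1) * (?w / m ^ d)))"
        by (intro small_mult mult power m(2) p(1) small_mem[OF p(1)])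
      moreover have "m * (m ^ (d - 1) * (?w / m ^ d)) = ?w"
        using d m(1) nz power_minus_mult[of d m] by (auto simp: field_simps)
      ultimately show ?thesis by (simp only:)
    qed
    ultimately show ?thesis by blast
  qed
qed

text \<open>For \<open>y\<close> outside the ball, the leading coefficient is
  \<open>poly f y / y ^ d\<close> minus an element of the ball divided by \<open>y\<close>. If there
  is no such \<open>y\<close>, the ball is the whole field.\<close>

lemma lead_coeff_mem:
  assumes p: "p \<in> P"
  shows "t * Polynomial.coeff f d \<in> R p"
proof (cases "\<exists>y. y \<notin> R p")
  case True
  then obtain y where y: "y \<notin> R p" by blast
  then have "y \<noteq> 0" using zero[OF p] by auto
  define h where "h = (poly f y - Polynomial.coeff f d * y ^ d) / y ^ (d - 1)"
  have "- (h * inverse y) \<in> R p"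
    using poly_lead[OF p y] total[OF p, of y] y
    by (intro uminus[OF p] mult[OF p]) (auto simp: h_def)
  then have "t * (poly f y / y ^ d + - (h * inverse y)) \<in> R p"
    using poly_outside[OF p y] by (intro add p) auto
  moreover have "y ^ d = y ^ (d - 1) * y" using d power_minus_mult[of d y] by simp
  then have "poly f y / y ^ d + - (h * inverse y) = Polynomial.coeff f d"
    using \<open>y \<noteq> 0\<close> by (simp add: h_def field_simps)
  ultimately show ?thesis by simp
qed blast

text \<open>On \<open>A\<close> the numerator of \<open>e\<close> is small and regularity bounds
  \<open>t / poly f x\<close>. On \<open>G\<close>, for \<open>x\<close> outside the ball, the
  leading terms cancel in \<open>1 - e\<close>, which by \<open>poly_lead\<close> is of the order of
  \<open>inverse x\<close> up to a factor \<open>1 / t\<close>.\<close>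

lemma bumpable_poly:
  assumes AG: "A \<subseteq> P" "G \<subseteq> P"
    and A: "\<And>p. p \<in> A \<Longrightarrow> regular p"
    and G: "\<And>q. q \<in> G \<Longrightarrow> regular q \<or> B q = nonunits (R q)"
  shows "bumpable A G"
  unfolding bumpable_def
proof (intro allI impI)
  fix l x assume x: "x \<noteq> 0" and sA: "\<forall>p\<in>A. small l p x" and sG: "\<forall>q\<in>G. small l q (inverse x)"
  define e where "e = Polynomial.coeff f d * x ^ d / poly f x"
  have "l p * e \<in> B p" if p: "p \<in> A" for p
  proof -
    have pP: "p \<in> P" and s: "small l p x" using p AG sA by auto
    have xR: "x \<in> R p" using small_mem[OF pP s] .
    have fx: "poly f x \<noteq> 0" "t / poly f x \<in> R p" using A[OF p] xR by (auto simp: regular_def)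
    have "(l p * x / t ^ 5) * (x ^ (d - 1) * (t * Polynomial.coeff f d) * (t / poly f x) * t ^ 3) \<in> B p"
      using s by (intro B_mult mult power t_mem pP xR fx lead_coeff_mem) (auto simp: small_def)
    moreover have "(l p * x / t ^ 5) * (x ^ (d - 1) * (t * Polynomial.coeff f d) * (t / poly f x) * t ^ 3)
        = l p * e"
    proof -
      have "x ^ d = x ^ (d - 1) * x" using d power_minus_mult[of d x] by simp
      moreover have "t ^ 5 = t * t * t ^ 3" by (simp add: eval_nat_numeral)
      ultimately show ?thesis using t by (simp add: e_def)
    qed
    ultimately show ?thesis by simp
  qed
  moreover have "l q * (1 - e) \<in> B q" if q: "q \<in> G" for q
  proof -
    have qP: "q \<in> P" and s: "small l q (inverse x)" using q AG sG by auto
    show ?thesis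
    proof (cases "x \<in> R q")
      case False
      note o = poly_outside[OF qP False] and h = poly_lead[OF qP False]
      have "(l q * inverse x / t ^ 5) * (((poly f x - Polynomial.coeff f d * x ^ d) / x ^ (d - 1)) *
          (t * x ^ d / poly f x) * t ^ 4) \<in> B q"
        using s by (intro B_mult mult power t_mem qP h) (use o in \<open>auto simp: small_def\<close>)
      moreover have "(l q * inverse x / t ^ 5) * (((poly f x - Polynomial.coeff f d * x ^ d) / x ^ (d - 1)) *
          (t * x ^ d / poly f x) * t ^ 4) = l q * (1 - e)"
      proof -
        have "x ^ d = x ^ (d - 1) * x" using d power_minus_mult[of d x] by simp
        moreover have "t ^ 5 = t * t ^ 4" by (simp add: eval_nat_numeral)
        ultimately have "(l q * inverse x / t ^ 5) * (((poly f x - Polynomial.coeff f d * x ^ d) / x ^ (d - 1)) *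
          (t * x ^ d / poly f x) * t ^ 4) = l q * ((poly f x - Polynomial.coeff f d * x ^ d) / poly f x)"
          using t x o by (simp add: divide_simps)
        then show ?thesis using o by (simp add: e_def diff_divide_distrib)
      qed
      ultimately show ?thesis by simp
    next
      \<comment> \<open>\<open>x\<close> and the small \<open>inverse x\<close> can both lie in the
        ball only if \<open>t\<close> is a unit there and \<open>B q\<close> is the full ball; then
        boundedness of \<open>l q\<close> and \<open>1 - e\<close> is enough.\<close>
      case True
      have "inverse x / t ^ 5 * x \<in> B q" using s True by (intro B_mult qP) (auto simp: small_def)
      then have T: "inverse t ^ 5 \<in> B q" using x by (simp add: field_simps)
      then have "inverse t \<in> R q"
        using unit_ball.power_inverse_mem[OF ball[OF qP], of "inverse t" 5] t_mem[OF qP] B_subset[OF qP] by simp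
      have "B q = R q"
      proof (rule ccontr)
        assume "B q \<noteq> R q"
        then have "inverse t ^ 5 * t ^ 5 \<in> nonunits (R q)"
          using T B[OF qP] by (intro nonunits_mult power t_mem qP) auto
        then show False using t unit_ball.one_notin_nonunits[OF ball[OF qP]] by (simp add: power_inverse)
      qed
      have "regular q" using G[OF q] \<open>B q = R q\<close> unit_ball.one_notin_nonunits[OF ball[OF qP]] one[OF qP] by auto
      then have fx: "poly f x \<noteq> 0" "t / poly f x \<in> R q" using True by (auto simp: regular_def)
      have "(l q * inverse x / t ^ 5) * x \<in> R q"
        using s True \<open>B q = R q\<close> by (intro mult qP) (auto simp: small_def)
      then have "l q / t ^ 5 * t ^ 5 \<in> R q"
        using x by (intro mult power t_mem qP) (simp add: field_simps)
      then have l: "l q \<in> R q" using t by simp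
      have "(t * Polynomial.coeff f d) * (t / poly f x) * x ^ d * inverse t ^ 2 \<in> R q"
        by (intro mult power qP lead_coeff_mem fx True \<open>inverse t \<in> R q\<close>)
      then have "- e \<in> R q"
        using t by (intro uminus qP) (simp add: e_def field_simps power2_eq_square)
      from add[OF qP one[OF qP] this] have "t * (1 + - e) * inverse t \<in> R q"
        using \<open>inverse t \<in> R q\<close> by (rule mult[OF qP])
      moreover have "t * (1 + - e) * inverse t = 1 - e" using t by simp
      ultimately have "1 - e \<in> R q" by (simp only:)
      with l \<open>B q = R q\<close> show ?thesis using mult[OF qP] by simp
    qed
  qed
  ultimately show "\<exists>e. (\<forall>p\<in>A. l p * e \<in> B p) \<and> (\<forall>q\<in>G. l q * (1 - e) \<in> B q)" by blast
qed

end

section \<open>Gluing partial solutions\<close>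

locale approximation_family = ball_family P R B t
  for P :: "'p set" and R B :: "'p \<Rightarrow> 'a::field set" and t :: 'a +
  fixes x z :: "'p \<Rightarrow> 'a"
  assumes z: "p \<in> P \<Longrightarrow> z p \<noteq> 0"
begin

text \<open>Every precision \<open>t ^ k\<close> is demanded because each gluing uses up one power
  of \<open>t\<close>.\<close>

definition solvable :: "'p set \<Rightarrow> bool" where
  "solvable A \<longleftrightarrow> (\<forall>k. \<exists>y. \<forall>p\<in>A. (y - x p) / (t ^ k * z p) \<in> B p)"

text \<open>
  \<open>R p * R q\<close> plays the role of the ring of the finest common coarsening of \<open>p\<close> and \<open>q\<close>.
\<close>

definition compatible :: "'p \<Rightarrow> 'p \<Rightarrow> bool" where
  "compatible p q \<longleftrightarrow>
     (\<forall>a\<in>R p * R q. \<forall>b\<in>R p * R q. a + b \<in> R p * R q) \<and> inverse t \<in> R p * R q \<and>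
     (x q - x p) / z p \<in> R p * R q \<and> z q / z p \<in> R p * R q \<and> z p / z q \<in> R p * R q \<and>
     (B p = R p \<or> \<not> R q \<subseteq> R p) \<and> (B q = R q \<or> \<not> R p \<subseteq> R q)"

text \<open>The covers that arise are given by \<open>small l\<close> with \<open>l p\<close> a
  constant divided by \<open>z p\<close>; \<open>a\<close> and \<open>b\<close> collect all factors
  independent of \<open>p\<close>.\<close>

definition coverable :: "'p set \<Rightarrow> bool" where
  "coverable A \<longleftrightarrow> (\<forall>a b. finite_subcover A (\<lambda>p w. a * w \<in> B p \<and> b / z p * w \<in> B p))"

text \<open>The partial solutions are interpolated as \<open>yA + e * (yG - yA)\<close> with
  \<open>e\<close> near 0 on \<open>A\<close> and near 1 on \<open>G\<close>. They are taken with
  precision \<open>Suc k\<close>, since \<open>B_add\<close> costs one factor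
  \<open>t\<close>.\<close>

lemma solvable_Un:
  assumes AG: "A \<subseteq> P" "G \<subseteq> P"
    and sol: "solvable A" "solvable G"
    and compat: "\<And>p q. p \<in> A \<Longrightarrow> q \<in> G \<Longrightarrow> compatible p q"
    and cover: "coverable A" "coverable G"
    and comb: "\<And>l. combinable A l" "\<And>l. combinable G l"
    and bump: "bumpable A G"
  shows "solvable (A \<union> G)"
  unfolding solvable_def
proof
  fix k
  show "\<exists>y. \<forall>p\<in>A \<union> G. (y - x p) / (t ^ k * z p) \<in> B p"
  proof (cases "A = {} \<or> G = {}")
    case True
    with sol show ?thesis unfolding solvable_def by auto
  next
    case False
    obtain yA where yA: "\<And>p. p \<in> A \<Longrightarrow> (yA - x p) / (t ^ Suc k * z p) \<in> B p"
      using sol(1) unfolding solvable_def by blast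
    obtain yG where yG: "\<And>p. p \<in> G \<Longrightarrow> (yG - x p) / (t ^ Suc k * z p) \<in> B p"
      using sol(2) unfolding solvable_def by blast
    define D where "D = yG - yA"
    \<comment> \<open>\<open>l p\<close> measures the discrepancy \<open>D\<close> in units of the
      precision required at \<open>p\<close>, so it tells how small \<open>e\<close> or
      \<open>1 - e\<close> must be there.\<close>
    define l where "l p = D / (t ^ Suc k * z p)" for p
    have small: "small l = (\<lambda>p w. inverse t ^ 5 * w \<in> B p \<and> (D / t ^ (k + 6)) / z p * w \<in> B p)"
    proof (intro ext)
      fix p w
      have "l p * w / t ^ 5 = (D / t ^ (k + 6)) / z p * w"
        by (simp add: l_def power_add eval_nat_numeral)
      moreover have "w / t ^ 5 = inverse t ^ 5 * w" by (simp add: field_simps)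
      ultimately show "small l p w \<longleftrightarrow> inverse t ^ 5 * w \<in> B p \<and> (D / t ^ (k + 6)) / z p * w \<in> B p"
        by (simp only: small_def)
    qed
    have fsc: "finite_subcover A (small l)" "finite_subcover G (small l)"
      using cover unfolding coverable_def small by blast+
    have pair: "\<exists>w. w \<noteq> 0 \<and> small l p w \<and> small l q (inverse w)" if pq: "p \<in> A" "q \<in> G" for p q
    proof -
      have P: "p \<in> P" "q \<in> P" using pq AG by auto
      note c = compat[OF pq, unfolded compatible_def]
      let ?M = "R p * R q"
      have M_mult: "a * b \<in> ?M" if "a \<in> ?M" "b \<in> ?M" for a b
        using that mult P unfolding set_times_def
        by (smt (verit) mem_Collect_eq mult.assoc mult.left_commute)
      have M_add: "a + b \<in> ?M" if "a \<in> ?M" "b \<in> ?M" for a b using c that by blast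
      have Rp: "R p \<subseteq> ?M" using set_times_intro[of _ "R p" 1 "R q"] one[OF P(2)] by fastforce
      have Rq: "R q \<subseteq> ?M" using set_times_intro[of 1 "R p" _ "R q"] one[OF P(1)] by fastforce
      have T: "inverse t ^ n \<in> ?M" for n
        using c Rp one[OF P(1)] by (induction n) (auto intro: M_mult)
      have 1: "(yG - x q) / z q \<in> ?M"
      proof -
        have "(yG - x q) / (t ^ Suc k * z q) * t ^ Suc k \<in> R q"
          by (intro mult power t_mem P B_subset yG pq)
        moreover have "(yG - x q) / (t ^ Suc k * z q) * t ^ Suc k = (yG - x q) / z q"
          using t by simp
        ultimately show ?thesis using Rq by auto
      qed
      have 2: "- ((yA - x p) / z p) \<in> ?M"
      proof -
        have "- ((yA - x p) / (t ^ Suc k * z p) * t ^ Suc k) \<in> R p"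
          by (intro uminus mult power t_mem P B_subset yA pq)
        moreover have "(yA - x p) / (t ^ Suc k * z p) * t ^ Suc k = (yA - x p) / z p"
          using t by simp
        ultimately show ?thesis using Rp by auto
      qed
      \<comment> \<open>\<open>D\<close> is split as
        \<open>(yG - x q) + (x q - x p) - (yA - x p)\<close>; divided by \<open>z p\<close>, each
        part lies in the product ring, where \<open>t\<close> is invertible.\<close>
      have "((yG - x q) / z q * (z q / z p) + (x q - x p) / z p + - ((yA - x p) / z p)) * inverse t ^ Suc k \<in> ?M"
        by (intro M_mult[OF _ T] M_add M_mult 1 2) (use c in auto)
      moreover have "((yG - x q) / z q * (z q / z p) + (x q - x p) / z p + - ((yA - x p) / z p)) * inverse t ^ Suc k = l p"
        using z[OF P(1)] z[OF P(2)] by (simp add: l_def D_def divide_simps)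
      ultimately have lp: "l p \<in> ?M" by simp
      then have "l p * (z p / z q) \<in> ?M" using c by (intro M_mult) auto
      then have lq: "l q \<in> ?M" using z[OF P(1)] by (simp add: l_def)
      have c': "inverse t \<in> ?M" "B p = R p \<or> \<not> R q \<subseteq> R p" "B q = R q \<or> \<not> R p \<subseteq> R q"
        using c by simp_all
      obtain w where "w \<noteq> 0" "small l p w" "small l q (inverse w)"
        by (rule pointwise_separation[where l = l, OF P c'(1) lp lq c'(2,3)])
      then show ?thesis by blast
    qed
    have ne: "A \<noteq> {}" "G \<noteq> {}" using False by simp_all
    have "\<exists>w. w \<noteq> 0 \<and> (\<forall>p\<in>A. small l p w) \<and> (\<forall>q\<in>G. small l q (inverse w))"
      by (rule separation[OF AG ne fsc comb pair]) auto
    then have "\<exists>e. (\<forall>p\<in>A. l p * e \<in> B p) \<and> (\<forall>q\<in>G. l q * (1 - e) \<in> B q)"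
      using bump unfolding bumpable_def by blast
    then obtain e where e: "\<forall>p\<in>A. l p * e \<in> B p" "\<forall>q\<in>G. l q * (1 - e) \<in> B q" by blast
    have "(yA + e * D - x p) / (t ^ k * z p) \<in> B p" if p: "p \<in> A" for p
    proof -
      have "t * ((yA - x p) / (t ^ Suc k * z p) + l p * e) \<in> B p"
        using p AG yA e by (intro B_add) auto
      moreover have "t * ((yA - x p) / (t ^ Suc k * z p) + l p * e) = (yA + e * D - x p) / (t ^ k * z p)"
        using t z[of p] p AG by (auto simp: l_def divide_simps algebra_simps)
      ultimately show ?thesis by simp
    qed
    moreover have "(yA + e * D - x q) / (t ^ k * z q) \<in> B q" if q: "q \<in> G" for q
    proof -
      have "t * ((yG - x q) / (t ^ Suc k * z q) + - (l q * (1 - e))) \<in> B q"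
        using q AG yG e by (intro B_add B_uminus) auto
      moreover have "t * ((yG - x q) / (t ^ Suc k * z q) + - (l q * (1 - e))) = (yA + e * D - x q) / (t ^ k * z q)"
      proof -
        have "(yG - x q) - D * (1 - e) = yA + e * D - x q" by (simp add: D_def algebra_simps)
        moreover have "t * ((yG - x q) / (t ^ Suc k * z q) + - (l q * (1 - e)))
            = ((yG - x q) - D * (1 - e)) / (t ^ k * z q)"
        proof -
          have "t * (u / (t * w) + - (D / (t * w) * (1 - e))) = (u - D * (1 - e)) / w" for u w
            using t by (cases "w = 0") (simp_all add: field_simps)
          then show ?thesis by (simp add: l_def mult.assoc)
        qed
        ultimately show ?thesis by simp
      qed
      ultimately show ?thesis by simp
    qed
    ultimately show ?thesis by blast
  qed
qed

end

section \<open>Unit balls of places\<close>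

abbreviation (input) type_ring :: "'a::field ring" where
  "type_ring \<equiv> ring_of_type_algebra"

lemma type_ring_simps [simp]:
  "carrier type_ring = UNIV" "x \<otimes>\<^bsub>type_ring\<^esub> y = x * y" "x \<oplus>\<^bsub>type_ring\<^esub> y = x + y"
  "\<one>\<^bsub>type_ring\<^esub> = 1" "\<zero>\<^bsub>type_ring\<^esub> = 0"
  by (simp_all add: ring_of_type_algebra_def)

lemma field_type_ring: "field (type_ring :: 'a::field ring)"
  by (rule field_from_type_algebra)

lemma type_ring_uminus [simp]: "\<ominus>\<^bsub>type_ring\<^esub> (x :: 'a::field) = - x"
proof -
  interpret field "type_ring :: 'a ring" by (rule field_type_ring)
  show ?thesis by (rule minus_equality) simp_all
qed

text \<open>Factor out the larger summand: \<open>a + b = a * c * (inverse c * (1 + b / a))\<close>.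
  A coarsening thus becomes a ring once it contains the constant \<open>c\<close> by which addition
  fails in \<open>R\<close>; later \<open>c\<close> is \<open>1\<close>, \<open>2\<close> or
  \<open>inverse t\<close>.\<close>

lemma coarsening_add_closed:
  assumes R: "unit_ball R" and R': "unit_ball R'" and sub: "R \<subseteq> R'"
    and c: "c \<noteq> 0" "c \<in> R'" and add: "\<And>a b. a \<in> R \<Longrightarrow> b \<in> R \<Longrightarrow> inverse c * (a + b) \<in> R"
    and ab: "a \<in> R'" "b \<in> R'"
  shows "a + b \<in> R'"
proof -
  interpret R: unit_ball R by fact
  interpret R': unit_ball R' by fact
  have *: "a + b \<in> R'" if "a \<in> R'" "a \<noteq> 0" "b / a \<in> R" for a b
  proof -
    have "a * c * (inverse c * (1 + b / a)) \<in> R'"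
      using that c sub add[OF R.one that(3)] by (intro R'.mult[of "a * c"] R'.mult[of a]) auto
    moreover have "a * c * (inverse c * (1 + b / a)) = a + b"
      using that c by (simp add: field_simps)
    ultimately show ?thesis by (simp only:)
  qed
  consider "a = 0" | "b = 0" | "a \<noteq> 0" "b \<noteq> 0" "b / a \<in> R" | "a \<noteq> 0" "b \<noteq> 0" "a / b \<in> R"
    using R.total[of "a / b"] by force
  then show ?thesis
    using ab *[of a b] *[of b a] by cases (auto simp: add.commute)
qed

lemma unit_ball_product:
  assumes "unit_ball R" "unit_ball R'"
  shows "unit_ball (R * R')" "R \<subseteq> R * R'" "R' \<subseteq> R * R'"
proof -
  interpret R: unit_ball R by fact
  interpret R': unit_ball R' by fact
  show sub: "R \<subseteq> R * R'" "R' \<subseteq> R * R'"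
    using set_times_intro[of _ R 1 R'] set_times_intro[of 1 R _ R'] R.one R'.one by fastforce+
  show "unit_ball (R * R')"
  proof
    show "a \<in> R * R' \<or> inverse a \<in> R * R'" for a using R.total[of a] sub by blast
    fix a b assume "a \<in> R * R'" "b \<in> R * R'"
    then obtain c c' e e' where "a = c * c'" "b = e * e'" "c \<in> R" "c' \<in> R'" "e \<in> R" "e' \<in> R'"
      by (auto elim!: set_times_elim)
    moreover from this have "(c * e) * (c' * e') \<in> R * R'"
      by (intro set_times_intro R.mult R'.mult)
    ultimately show "a * b \<in> R * R'" by (simp add: mult_ac)
  qed
qed

section \<open>Orderings and their unit intervals\<close>

locale positive_cone =
  fixes C :: "'a::field set"
  assumes add: "a \<in> C \<Longrightarrow> b \<in> C \<Longrightarrow> a + b \<in> C"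
    and mult: "a \<in> C \<Longrightarrow> b \<in> C \<Longrightarrow> a * b \<in> C"
    and total: "a \<in> C \<or> - a \<in> C"
    and pointed: "a \<in> C \<Longrightarrow> - a \<in> C \<Longrightarrow> a = 0"
begin

definition interval :: "'a set" where
  "interval = {x. 1 - x \<in> C \<and> 1 + x \<in> C}"

lemma square: "a * a \<in> C"
  using mult[of a a] mult[of "- a" "- a"] total[of a] by auto

lemma zero: "0 \<in> C" using square[of 0] by simp

lemma one: "1 \<in> C" using square[of 1] by simp

lemma two: "2 \<in> C" using add[OF one one] by simp

lemma two_nonzero: "(2 :: 'a) \<noteq> 0"
proof
  assume "(2 :: 'a) = 0"
  then have "(1 :: 'a) = - 1" by (simp add: eq_neg_iff_add_eq_0)
  with one have "- 1 \<in> C" by metis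
  with pointed[OF one] show False by simp
qed

lemma inverse: "a \<in> C \<Longrightarrow> inverse a \<in> C"
  using mult[OF _ square[of "inverse a"], of a] by (cases "a = 0") (simp_all add: field_simps)

lemma half: "2 * a \<in> C \<Longrightarrow> a \<in> C"
  using mult[OF _ inverse[OF two], of "2 * a"] two_nonzero by simp

lemma mem_iff_uminus: "a \<in> C \<longleftrightarrow> - a \<notin> C \<or> a = 0"
  using total[of a] pointed[of a] zero by auto

lemma inverse_interval:
  assumes "a \<in> C" "b - a \<in> C" "b \<noteq> 0"
  shows "a / b \<in> interval"
proof -
  have b: "inverse b \<in> C" using add[OF assms(1,2)] inverse by simp
  have "(b - a) * inverse b \<in> C" "1 + a * inverse b \<in> C"
    using assms b one by (auto intro: mult add)
  then show ?thesis using assms(3) by (simp add: interval_def field_simps)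
qed

lemma notin_interval: "x \<notin> interval \<Longrightarrow> x - 1 \<in> C \<or> - x - 1 \<in> C"
  using total[of "x - 1"] total[of "- x - 1"] by (auto simp: interval_def)

text \<open>Products are handled by
  \<open>2 * (1 - a * b) = (1 - a) * (1 + b) + (1 + a) * (1 - b)\<close> and its counterpart for
  \<open>1 + a * b\<close>.\<close>

lemma unit_ball_interval: "unit_ball interval"
proof
  fix a b assume "a \<in> interval" "b \<in> interval"
  then have "(1 - a) * (1 + b) + (1 + a) * (1 - b) \<in> C" "(1 - a) * (1 - b) + (1 + a) * (1 + b) \<in> C"
    by (auto simp: interval_def intro!: add mult)
  then have "2 * (1 - a * b) \<in> C" "2 * (1 + a * b) \<in> C" by (simp_all add: algebra_simps)
  then show "a * b \<in> interval" using half by (auto simp: interval_def)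
next
  fix a
  have *: "inverse a \<in> interval" if "a - 1 \<in> C" for a
    using inverse_interval[OF one that] add[OF that one] one zero
    by (cases "a = 0") (auto simp: divide_inverse interval_def)
  have "inverse a \<in> interval" if "- a - 1 \<in> C"
    using *[OF that] by (simp add: interval_def)
  then show "a \<in> interval \<or> inverse a \<in> interval"
    using * notin_interval by blast
qed

text \<open>If \<open>x\<close> and \<open>inverse x\<close> lie in the interval, then
  \<open>1 - x * x\<close> is both nonnegative and nonpositive, so \<open>x\<close> is 1 or
  -1.\<close>

lemma nonunits_interval: "nonunits interval = interval - {1, - 1}"
proof -
  interpret U: unit_ball interval by (rule unit_ball_interval)
  have "x = 1 \<or> x = - 1" if "x \<in> interval" "inverse x \<in> interval" "x \<noteq> 0" for x
  proof -
    have "(1 - x) * (1 + x) \<in> C" using that by (auto simp: interval_def intro!: mult)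
    moreover have "(1 - inverse x) * (1 + inverse x) * (x * x) \<in> C"
      using that by (auto simp: interval_def intro!: mult square)
    moreover have "(1 - inverse x) * (1 + inverse x) * (x * x) = - ((1 - x) * (1 + x))"
      using that by (simp add: field_simps)
    ultimately have "(1 - x) * (1 + x) = 0" using pointed by metis
    then show ?thesis by (auto simp: eq_neg_iff_add_eq_0 add.commute)
  qed
  then have "x \<in> interval - {1, - 1} \<Longrightarrow> x \<in> nonunits interval" for x
    by (auto simp: nonunits_def)
  moreover have "1 \<notin> nonunits interval" "- 1 \<notin> nonunits interval"
    using U.one U.minus_one by (simp_all add: nonunits_def)
  ultimately show ?thesis using U.nonunits_subset by blast
qed

lemma interval_add:
  assumes "a \<in> interval" "b \<in> interval"
  shows "inverse 2 * (a + b) \<in> interval"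
proof -
  have "(1 - a) + (1 - b) \<in> C" "(1 + a) + (1 + b) \<in> C"
    using assms unfolding interval_def by (blast intro: add)+
  moreover have "(1 - a) + (1 - b) = 2 * (1 - inverse 2 * (a + b))"
    "(1 + a) + (1 + b) = 2 * (1 + inverse 2 * (a + b))"
    using two_nonzero by (simp_all add: algebra_simps)
  ultimately show ?thesis using half by (simp add: interval_def)
qed

text \<open>Bernoulli's inequality for the exponent \<open>2 ^ n\<close>, proved by repeated
  squaring, bounds \<open>2 ^ n * (x - 1)\<close> by \<open>x ^ (2 ^ n) - 1\<close>, which is at
  most 1.\<close>

lemma infinitesimal:
  assumes x: "x - 1 \<in> C" and bd: "\<And>n. 2 - x ^ n \<in> C"
  shows "2 ^ n * (x - 1) \<in> interval"
proof -
  have 1: "x ^ (2 ^ n) - 1 - 2 ^ n * (x - 1) \<in> C" for n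
  proof (induction n)
    case 0
    then show ?case using zero by simp
  next
    case (Suc n)
    let ?b = "x ^ (2 ^ n) - 1"
    have "2 * (?b - 2 ^ n * (x - 1)) + ?b * ?b \<in> C"
      by (intro add mult two Suc square)
    moreover have "2 * (u - 1 - k * (x - 1)) + (u - 1) * (u - 1) = u * u - 1 - 2 * k * (x - 1)" for u k
      by (simp add: algebra_simps)
    moreover have "x ^ (2 ^ Suc n) = x ^ (2 ^ n) * x ^ (2 ^ n)" by (simp add: mult_2 power_add)
    ultimately show ?case by (simp only: power_Suc)
  qed
  have "(2 - x ^ (2 ^ n)) + (x ^ (2 ^ n) - 1 - 2 ^ n * (x - 1)) \<in> C"
    by (intro add bd 1)
  moreover have "2 ^ n * (x - 1) \<in> C"
    using x two one by (induction n) (auto intro: mult simp: mult.assoc)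
  ultimately show ?thesis using one by (simp add: interval_def add)
qed

end

text \<open>The interval determines the ordering: if \<open>a\<close> is between 0 and 1 for
  \<open>C\<close>, then \<open>1 - 2 * a\<close> lies in both intervals, so \<open>a\<close> is
  nonnegative for \<open>D\<close>. Larger elements follow by inversion.\<close>

lemma interval_subset_eq:
  assumes "positive_cone C" "positive_cone D"
    and sub: "positive_cone.interval C \<subseteq> positive_cone.interval D"
  shows "positive_cone.interval C = positive_cone.interval D"
proof -
  interpret C: positive_cone C by fact
  interpret D: positive_cone D by fact
  have *: "a \<in> D" if "a \<in> C" "a \<in> C.interval" for a
  proof -
    have "1 - a \<in> C" using that by (simp add: C.interval_def)
    then have "2 * a \<in> C" "2 * (1 - a) \<in> C"
      using that C.mult[OF C.two] by blast+
    then have "1 - 2 * a \<in> C.interval" by (simp add: C.interval_def algebra_simps)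
    then have "2 * a \<in> D" using sub by (auto simp: D.interval_def)
    then show ?thesis by (rule D.half)
  qed
  have "a \<in> D" if "a \<in> C" for a
    using *[of a] *[of "inverse a"] C.inverse[OF that] D.inverse[of "inverse a"]
      unit_ball.total[OF C.unit_ball_interval, of a] that by auto
  then have "C = D"
    using C.mem_iff_uminus D.mem_iff_uminus C.zero by blast
  then show ?thesis by simp
qed

lemma positive_cone_of_ordering:
  assumes r: "field_ordering (type_ring :: 'a::field ring) r"
  obtains C where "positive_cone C"
    "place_O type_ring (Ordering r) = positive_cone.interval C"
    "place_m type_ring (Ordering r) = nonunits (positive_cone.interval C)"
proof -
  define C where "C = {x. (0, x) \<in> r}"
  have lin: "antisym r" "total_on UNIV r" "refl_on UNIV r" "Relation.trans r"
    using r by (auto simp: field_ordering_def order_on_defs)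
  have add: "(x + z, y + z) \<in> r" if "(x, y) \<in> r" for x y z
    using r that by (auto simp: field_ordering_def)
  have le: "(x, y) \<in> r \<longleftrightarrow> y - x \<in> C" for x y
    using add[of x y "- x"] add[of 0 "y - x" x] by (auto simp: C_def)
  have refl: "(x, x) \<in> r" for x using lin(3) by (auto simp: refl_on_def)
  interpret positive_cone C
  proof
    show "a + b \<in> C" if "a \<in> C" "b \<in> C" for a b
      using add[of 0 b a] that lin(4) by (auto simp: C_def add.commute dest: transD)
    show "a * b \<in> C" if "a \<in> C" "b \<in> C" for a b
      using r that by (auto simp: field_ordering_def C_def)
    show "a \<in> C \<or> - a \<in> C" for a
    proof (cases "a = 0")
      case True
      then show ?thesis using refl by (simp add: C_def)
    next
      case False
      then have "(0, a) \<in> r \<or> (a, 0) \<in> r" using lin(2) by (auto simp: total_on_def)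
      then show ?thesis by (simp add: le)
    qed
    show "a = 0" if "a \<in> C" "- a \<in> C" for a
      using that lin(1) le[of 0 a] le[of a 0] by (auto dest: antisymD)
  qed
  have O: "place_O type_ring (Ordering r) = interval"
    by (auto simp: le interval_def add.commute)
  have "place_m type_ring (Ordering r) = place_O type_ring (Ordering r) - {1, - 1}"
    by auto
  then show ?thesis
    using that[OF positive_cone_axioms O] by (simp only: O nonunits_interval)
qed

section \<open>Absolute values and Krull valuations\<close>

lemma absolute_value_ball:
  assumes a: "absolute_value (type_ring :: 'a::field ring) a"
  shows "unit_ball {x. a x \<le> 1}" "{x. a x < 1} = nonunits {x. a x \<le> 1}"
proof -
  have a0: "a x \<ge> 0" "a x = 0 \<longleftrightarrow> x = 0" and am: "a (x * y) = a x * a y" for x y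
    using a by (auto simp: absolute_value_def)
  have a1: "a 1 = 1" using abs_one[OF field_type_ring a] by simp
  have ai: "a (inverse x) = inverse (a x)" for x
    using am[of x "inverse x"] a1 a0(2)[of 0] by (cases "x = 0") (auto simp: inverse_unique)
  show "unit_ball {x. a x \<le> 1}"
  proof
    show "x * y \<in> {x. a x \<le> 1}" if "x \<in> {x. a x \<le> 1}" "y \<in> {x. a x \<le> 1}" for x y
      using that a0 mult_le_one[of "a x" "a y"] by (simp add: am)
    show "x \<in> {x. a x \<le> 1} \<or> inverse x \<in> {x. a x \<le> 1}" for x
      by (auto simp: ai intro: inverse_le_1_iff[THEN iffD2])
  qed
  have "a x < 1 \<longleftrightarrow> x \<in> nonunits {x. a x \<le> 1}" for x
  proof (cases "x = 0")
    case True
    then have "a x = 0" using a0(2) by blast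
    then show ?thesis by (simp add: nonunits_def True)
  next
    case False
    then have "0 < a x" using a0[of x] by (simp add: less_le)
    then show ?thesis by (simp add: nonunits_def ai not_le one_less_inverse_iff False)
  qed
  then show "{x. a x < 1} = nonunits {x. a x \<le> 1}" by blast
qed

lemma krull_valuation_ball:
  assumes v: "krull_valuation (type_ring :: 'a::field ring) \<Gamma> r v"
  defines "R \<equiv> place_O type_ring (Valuation \<Gamma> r v)"
  shows "unit_ball R" "place_m type_ring (Valuation \<Gamma> r v) = nonunits R"
    "\<And>a b. a \<in> R \<Longrightarrow> b \<in> R \<Longrightarrow> a + b \<in> R"
proof -
  have og: "ordered_abelian_group \<Gamma> r" using v by (simp add: krull_valuation_def)
  interpret G: comm_group \<Gamma> using og by (simp add: ordered_abelian_group_def)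
  have lin: "antisym r" "total_on (carrier \<Gamma>) r" "refl_on (carrier \<Gamma>) r" "Relation.trans r"
    using og by (auto simp: ordered_abelian_group_def order_on_defs)
  have tr: "(g, h) \<in> r" if "(g, k) \<in> r" "(k, h) \<in> r" for g h k
    using lin(4) that by (rule transD)
  have rm: "(g \<otimes>\<^bsub>\<Gamma>\<^esub> k, h \<otimes>\<^bsub>\<Gamma>\<^esub> k) \<in> r" if "(g, h) \<in> r" "k \<in> carrier \<Gamma>" for g h k
    using og that by (auto simp: ordered_abelian_group_def)
  have v0: "v x = None \<longleftrightarrow> x = 0" and vm: "v (x * y) = val_add \<Gamma> (v x) (v y)"
    and va: "val_le r (v x) (v (x + y)) \<or> val_le r (v y) (v (x + y))" for x y
    using v by (simp_all add: krull_valuation_def)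
  have vc: "v x \<in> insert None (Some ` carrier \<Gamma>)" for x
    using v unfolding krull_valuation_def type_ring_simps by blast
  have v1: "v 1 = Some \<one>\<^bsub>\<Gamma>\<^esub>" using val_one[OF field_type_ring v] by simp
  have vs: "\<exists>g\<in>carrier \<Gamma>. v x = Some g \<and> v (inverse x) = Some (inv\<^bsub>\<Gamma>\<^esub> g)" if x: "x \<noteq> 0" for x
  proof -
    obtain g h where gh: "v x = Some g" "v (inverse x) = Some h" "g \<in> carrier \<Gamma>" "h \<in> carrier \<Gamma>"
      using vc[of x] vc[of "inverse x"] v0[of x] v0[of "inverse x"] x by auto
    have "h \<otimes>\<^bsub>\<Gamma>\<^esub> g = \<one>\<^bsub>\<Gamma>\<^esub>"
      using vm[of "inverse x" x] x gh v1 by (simp add: val_add_def)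
    then show ?thesis using gh G.inv_equality[of h g] by auto
  qed
  have memR: "x \<in> R \<longleftrightarrow> x = 0 \<or> (\<exists>g. v x = Some g \<and> (\<one>\<^bsub>\<Gamma>\<^esub>, g) \<in> r)" for x
    using v0[of x] by (cases "v x") (auto simp: R_def val_le_def)
  have inv_le: "(\<one>\<^bsub>\<Gamma>\<^esub>, inv\<^bsub>\<Gamma>\<^esub> g) \<in> r \<longleftrightarrow> (g, \<one>\<^bsub>\<Gamma>\<^esub>) \<in> r" if "g \<in> carrier \<Gamma>" for g
    using rm[of "\<one>\<^bsub>\<Gamma>\<^esub>" "inv\<^bsub>\<Gamma>\<^esub> g" g] rm[of g "\<one>\<^bsub>\<Gamma>\<^esub>" "inv\<^bsub>\<Gamma>\<^esub> g"] that by auto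
  have tot: "(\<one>\<^bsub>\<Gamma>\<^esub>, g) \<in> r \<or> (g, \<one>\<^bsub>\<Gamma>\<^esub>) \<in> r" if "g \<in> carrier \<Gamma>" for g
    using lin(2,3) that by (cases "g = \<one>\<^bsub>\<Gamma>\<^esub>") (auto simp: total_on_def refl_on_def)
  show "unit_ball R"
  proof
    fix a b assume ab: "a \<in> R" "b \<in> R"
    show "a * b \<in> R"
    proof (cases "a = 0 \<or> b = 0")
      case False
      then obtain g h where gh: "v a = Some g" "v b = Some h" "(\<one>\<^bsub>\<Gamma>\<^esub>, g) \<in> r" "(\<one>\<^bsub>\<Gamma>\<^esub>, h) \<in> r"
        using ab memR by blast
      have "g \<in> carrier \<Gamma>" "h \<in> carrier \<Gamma>" using vc[of a] vc[of b] gh by auto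
      then have "(h, g \<otimes>\<^bsub>\<Gamma>\<^esub> h) \<in> r" using rm[OF gh(3), of h] by simp
      then have "(\<one>\<^bsub>\<Gamma>\<^esub>, g \<otimes>\<^bsub>\<Gamma>\<^esub> h) \<in> r" using gh(4) by (rule tr[rotated])
      then show ?thesis using gh by (simp add: memR vm val_add_def)
    qed (auto simp: memR)
  next
    fix a show "a \<in> R \<or> inverse a \<in> R"
    proof (cases "a = 0")
      case False
      then obtain g where "g \<in> carrier \<Gamma>" "v a = Some g" "v (inverse a) = Some (inv\<^bsub>\<Gamma>\<^esub> g)"
        using vs by blast
      then show ?thesis using tot inv_le by (auto simp: memR)
    qed (simp add: memR)
  qed
  have "(x \<in> R \<and> v x \<noteq> Some \<one>\<^bsub>\<Gamma>\<^esub>) \<longleftrightarrow> x \<in> nonunits R" for x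
  proof (cases "x = 0")
    case False
    then obtain g where g: "g \<in> carrier \<Gamma>" "v x = Some g" "v (inverse x) = Some (inv\<^bsub>\<Gamma>\<^esub> g)"
      using vs by blast
    have "(\<one>\<^bsub>\<Gamma>\<^esub>, g) \<in> r \<and> g \<noteq> \<one>\<^bsub>\<Gamma>\<^esub> \<longleftrightarrow> (g, \<one>\<^bsub>\<Gamma>\<^esub>) \<notin> r"
      using tot[OF g(1)] lin(1,3) g(1) by (auto simp: refl_on_def dest: antisymD)
    then show ?thesis using False g inv_le[OF g(1)] by (simp add: nonunits_def memR)
  qed (use v0[of 0] in \<open>auto simp: nonunits_def memR\<close>)
  then show "place_m type_ring (Valuation \<Gamma> r v) = nonunits R"
    by (auto simp: R_def)
  show "a + b \<in> R" if "a \<in> R" "b \<in> R" for a b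
    using va[of a b] that tr by (auto simp: R_def val_le_def split: option.splits)
qed

text \<open>The value group consists of the principal fractional ideals, ordered by reverse inclusion.\<close>

lemma krull_valuation_of_ring:
  fixes M :: "'a::field set"
  assumes "unit_ball M" and add: "\<And>a b. a \<in> M \<Longrightarrow> b \<in> M \<Longrightarrow> a + b \<in> M"
  obtains \<Gamma> r v where "krull_valuation type_ring \<Gamma> r v"
    "place_O type_ring (Valuation \<Gamma> r v) = M"
    "\<forall>a b. val_le r (v a) (v b) \<longleftrightarrow> b = 0 \<or> (a \<noteq> 0 \<and> b / a \<in> M)"
proof -
  interpret M: unit_ball M by fact
  have mem: "b \<in> a *o M \<longleftrightarrow> b / a \<in> M" if "a \<noteq> 0" for a b
    using that by (auto simp: elt_set_times_def intro!: bexI[of _ "b / a"])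
  have sub: "b *o M \<subseteq> a *o M \<longleftrightarrow> b / a \<in> M" if "a \<noteq> 0" for a b
  proof
    assume "b *o M \<subseteq> a *o M"
    then have "b \<in> a *o M" using M.one by (force simp: elt_set_times_def)
    then show "b / a \<in> M" using mem that by blast
  next
    assume "b / a \<in> M"
    show "b *o M \<subseteq> a *o M"
    proof
      fix y assume "y \<in> b *o M"
      then obtain c where "c \<in> M" "y = b * c" by (auto simp: elt_set_times_def)
      then show "y \<in> a *o M" using M.mult[OF \<open>b / a \<in> M\<close>, of c] by (simp add: mem[OF that])
    qed
  qed
  have MM: "M * M = M"
    using M.one M.mult by (auto simp: set_times_def) (metis mult_1)
  have times: "(a *o M) * (b *o M) = (a * b) *o M" for a b
    using MM by (metis set_times_rearrange)
  \<comment> \<open>Fractional ideals are sets of field elements, as the type of value groups in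
    \<open>Valuation\<close> demands. By \<open>times\<close> the plain set product already
    multiplies them.\<close>
  define \<Gamma> :: "'a set monoid" where
    "\<Gamma> = \<lparr>carrier = {a *o M | a. a \<noteq> 0}, monoid.mult = (*), one = M\<rparr>"
  define r where "r = {(A, B). A \<in> carrier \<Gamma> \<and> B \<in> carrier \<Gamma> \<and> B \<subseteq> A}"
  define v where "v a = (if a = 0 then None else Some (a *o M))" for a
  have simps: "carrier \<Gamma> = {a *o M | a. a \<noteq> 0}" "A \<otimes>\<^bsub>\<Gamma>\<^esub> B = A * B" "\<one>\<^bsub>\<Gamma>\<^esub> = M" for A B
    by (simp_all add: \<Gamma>_def)
  have one: "1 *o M = M" by (simp add: elt_set_times_def)
  have car: "a *o M \<in> carrier \<Gamma>" if "a \<noteq> 0" for a using that by (auto simp: simps)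
  have "comm_group \<Gamma>"
  proof (rule comm_groupI)
    show "\<one>\<^bsub>\<Gamma>\<^esub> \<in> carrier \<Gamma>" using car[of 1] by (simp add: simps(3) one)
    show "\<exists>y\<in>carrier \<Gamma>. y \<otimes>\<^bsub>\<Gamma>\<^esub> x = \<one>\<^bsub>\<Gamma>\<^esub>" if x: "x \<in> carrier \<Gamma>" for x
    proof -
      obtain a where "x = a *o M" "a \<noteq> 0" using x by (auto simp: simps)
      then show ?thesis
        using car[of "inverse a"] by (intro bexI[of _ "inverse a *o M"]) (simp_all add: simps(2,3) times one)
    qed
    show "\<one>\<^bsub>\<Gamma>\<^esub> \<otimes>\<^bsub>\<Gamma>\<^esub> x = x" if "x \<in> carrier \<Gamma>" for x
      using that times[of 1] by (auto simp: simps one)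
  qed (auto simp: simps times mult_ac)
  moreover have "linear_order_on (carrier \<Gamma>) r"
  proof -
    have "A \<subseteq> B \<or> B \<subseteq> A" if AB: "A \<in> carrier \<Gamma>" "B \<in> carrier \<Gamma>" for A B
    proof -
      obtain a b where "A = a *o M" "B = b *o M" "a \<noteq> 0" "b \<noteq> 0" using AB by (auto simp: simps)
      then show ?thesis using sub M.total[of "a / b"] by auto
    qed
    then show ?thesis
      by (auto simp: order_on_defs r_def refl_on_def antisym_def total_on_def intro!: transI)
  qed
  moreover have "(A \<otimes>\<^bsub>\<Gamma>\<^esub> B, A' \<otimes>\<^bsub>\<Gamma>\<^esub> B) \<in> r" if AB: "(A, A') \<in> r" "B \<in> carrier \<Gamma>" for A A' B
  proof -
    obtain a a' b where "A = a *o M" "A' = a' *o M" "B = b *o M" "a \<noteq> 0" "a' \<noteq> 0" "b \<noteq> 0"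
      using AB by (auto simp: simps r_def)
    with AB show ?thesis by (auto simp: r_def simps times sub)
  qed
  ultimately have og: "ordered_abelian_group \<Gamma> r"
    by (auto simp: ordered_abelian_group_def)
  have le: "val_le r (v a) (v b) \<longleftrightarrow> b = 0 \<or> (a \<noteq> 0 \<and> b / a \<in> M)" for a b
    using car by (auto simp: v_def val_le_def r_def sub)
  have v: "krull_valuation type_ring \<Gamma> r v"
    unfolding krull_valuation_def
  proof (intro conjI ballI og)
    show "v x \<in> insert None (Some ` carrier \<Gamma>)" for x
      using car by (auto simp: v_def)
    show "(v x = None) = (x = \<zero>\<^bsub>type_ring\<^esub>)" for x by (simp add: v_def)
    show "v (x \<otimes>\<^bsub>type_ring\<^esub> y) = val_add \<Gamma> (v x) (v y)" for x y
      by (auto simp: v_def val_add_def simps times)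
    show "val_le r (v x) (v (x \<oplus>\<^bsub>type_ring\<^esub> y)) \<or> val_le r (v y) (v (x \<oplus>\<^bsub>type_ring\<^esub> y))" for x y
    proof -
      consider "x = 0" | "y = 0" | "x \<noteq> 0" "y \<noteq> 0" "y / x \<in> M" | "x \<noteq> 0" "y \<noteq> 0" "x / y \<in> M"
        using M.total[of "y / x"] by force
      then show ?thesis
        using add[OF M.one, of "y / x"] add[OF _ M.one, of "x / y"] M.one
        by cases (auto simp: le add_divide_distrib)
    qed
  qed
  show ?thesis
  proof (rule that[OF v])
    show "place_O type_ring (Valuation \<Gamma> r v) = M"
      using le[of 1] M.zero by (auto simp: simps v_def one)
    show "\<forall>a b. val_le r (v a) (v b) \<longleftrightarrow> b = 0 \<or> (a \<noteq> 0 \<and> b / a \<in> M)"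
      using le by blast
  qed
qed

section \<open>Localities\<close>

lemma place_unit_ball:
  fixes p :: "'a::field place"
  assumes "is_place type_ring p"
  shows "unit_ball (place_O type_ring p) \<and> place_m type_ring p = nonunits (place_O type_ring p)"
proof (cases p)
  case (Valuation \<Gamma> r v)
  with assms krull_valuation_ball[of \<Gamma> r v] show ?thesis by simp
next
  case (Ordering r)
  with assms have "field_ordering type_ring r" by simp
  then obtain C where "positive_cone C" "place_O type_ring p = positive_cone.interval C"
    "place_m type_ring p = nonunits (positive_cone.interval C)"
    using positive_cone_of_ordering Ordering by blast
  then show ?thesis using positive_cone.unit_ball_interval by simp
next
  case (Absolute_Value a)
  with assms absolute_value_ball[of a] show ?thesis by simp
qed

lemma localityE:
  assumes "v \<in> localities (type_ring :: 'a::field ring)"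
  obtains p where "is_place type_ring p" "v = locality_of type_ring p"
    "loc_O type_ring v = place_O type_ring p" "loc_m type_ring v = place_m type_ring p"
proof -
  obtain p where "is_place type_ring p" "v = locality_of type_ring p"
    using assms by (auto simp: localities_def)
  then show ?thesis
    using that loc_O_locality_of[OF field_type_ring] loc_m_locality_of[OF field_type_ring] by blast
qed

lemma locality_unit_ball:
  assumes "v \<in> localities (type_ring :: 'a::field ring)"
  shows "unit_ball (loc_O type_ring v)" "loc_m type_ring v = nonunits (loc_O type_ring v)"
proof -
  obtain p where "is_place type_ring p" "loc_O type_ring v = place_O type_ring p"
    "loc_m type_ring v = place_m type_ring p"
    using localityE[OF assms] by metis
  then show "unit_ball (loc_O type_ring v)" "loc_m type_ring v = nonunits (loc_O type_ring v)"
    using place_unit_ball[of p] by simp_all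
qed

lemma locality_cases:
  assumes v: "v \<in> localities (type_ring :: 'a::field ring)"
  obtains (ring) "\<And>a b. a \<in> loc_O type_ring v \<Longrightarrow> b \<in> loc_O type_ring v \<Longrightarrow> a + b \<in> loc_O type_ring v"
  | (ordering) C where "positive_cone C" "loc_O type_ring v = positive_cone.interval C"
      "v \<in> S_ord type_ring"
  | (absolute) a where "absolute_value type_ring a" "loc_O type_ring v = {x. a x \<le> 1}"
proof -
  obtain p where p: "is_place type_ring p" "v = locality_of type_ring p"
    "loc_O type_ring v = place_O type_ring p"
    using localityE[OF v] by metis
  show ?thesis
  proof (cases p)
    case (Valuation \<Gamma> r w)
    then have "krull_valuation type_ring \<Gamma> r w" using p by simp
    from krull_valuation_ball(3)[OF this] show ?thesis
      using ring p(3) Valuation by simp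
  next
    case (Ordering r)
    then have r: "field_ordering type_ring r" using p by simp
    then obtain C where "positive_cone C" "loc_O type_ring v = positive_cone.interval C"
      using positive_cone_of_ordering Ordering p(3) by metis
    moreover have "v \<in> S_ord type_ring" using p(2) r Ordering by (auto simp: S_ord_def)
    ultimately show ?thesis using ordering by blast
  next
    case (Absolute_Value a)
    then show ?thesis using absolute p by simp
  qed
qed

lemma locality_of_ring:
  fixes M :: "'a::field set"
  assumes "unit_ball M" "\<And>a b. a \<in> M \<Longrightarrow> b \<in> M \<Longrightarrow> a + b \<in> M"
  obtains \<Gamma> r v where "krull_valuation type_ring \<Gamma> r v"
    "locality_of type_ring (Valuation \<Gamma> r v) \<in> localities type_ring"
    "loc_O type_ring (locality_of type_ring (Valuation \<Gamma> r v)) = M"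
    "\<forall>a b. val_le r (v a) (v b) \<longleftrightarrow> b = 0 \<or> (a \<noteq> 0 \<and> b / a \<in> M)"
proof -
  obtain \<Gamma> r v where v: "krull_valuation type_ring \<Gamma> r v"
    "place_O type_ring (Valuation \<Gamma> r v) = M"
    "\<forall>a b. val_le r (v a) (v b) \<longleftrightarrow> b = 0 \<or> (a \<noteq> 0 \<and> b / a \<in> M)"
    by (rule krull_valuation_of_ring[OF assms])
  have p: "is_place type_ring (Valuation \<Gamma> r v)" using v(1) by simp
  show ?thesis
  proof (rule that[OF v(1)])
    show "locality_of type_ring (Valuation \<Gamma> r v) \<in> localities type_ring"
      using p unfolding localities_def by blast
    show "loc_O type_ring (locality_of type_ring (Valuation \<Gamma> r v)) = M"
      using loc_O_locality_of[OF field_type_ring p] v(2) by simp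
    show "\<forall>a b. val_le r (v a) (v b) \<longleftrightarrow> b = 0 \<or> (a \<noteq> 0 \<and> b / a \<in> M)" by (rule v(3))
  qed
qed

section \<open>Finest common coarsenings and products of balls\<close>

text \<open>\<open>locality_of_ring\<close> turns \<open>M\<close> into a locality, which is then a
  common coarsening to compare \<open>u\<close> with.\<close>

lemma finest_common_coarsening_subset:
  fixes M :: "'a::field set"
  assumes u: "finest_common_coarsening type_ring v w u" and M: "unit_ball M"
    and add: "\<And>a b. a \<in> M \<Longrightarrow> b \<in> M \<Longrightarrow> a + b \<in> M"
    and vw: "loc_O type_ring v \<subseteq> M" "loc_O type_ring w \<subseteq> M"
  shows "loc_O type_ring u \<subseteq> M"
proof -
  obtain \<Gamma> r v' where m: "locality_of type_ring (Valuation \<Gamma> r v') \<in> localities type_ring"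
    "loc_O type_ring (locality_of type_ring (Valuation \<Gamma> r v')) = M"
    by (rule locality_of_ring[OF M add])
  then show ?thesis using u vw unfolding finest_common_coarsening_def is_refinement_def by metis
qed

lemma nonunits_add:
  assumes R: "unit_ball R" and add: "\<And>a b. a \<in> R \<Longrightarrow> b \<in> R \<Longrightarrow> a + b \<in> R"
    and ab: "a \<in> nonunits R" "b \<in> nonunits R"
  shows "a + b \<in> nonunits R"
proof -
  interpret ball_family "{()}" "\<lambda>_. R" "\<lambda>_. nonunits R" 1
    using R add by (intro ball_family.intro) auto
  show ?thesis using B_add[of "()" a b] ab by simp
qed

text \<open>The archimedean property: some \<open>b\<close> in \<open>R'\<close> has value above 1,
  so every \<open>x\<close> is \<open>x / b ^ n\<close> times \<open>b ^ n\<close> with the first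
  factor in \<open>R\<close> for large \<open>n\<close>.\<close>

lemma product_eq_UNIV:
  fixes a :: "'a::field \<Rightarrow> real"
  assumes a: "absolute_value type_ring a" and O: "R = {x. a x \<le> 1}"
    and R': "unit_ball R'" and sub: "\<not> R' \<subseteq> R"
  shows "R * R' = UNIV"
proof -
  obtain b where b: "b \<in> R'" "a b > 1" using sub O by force
  have a0: "a x \<ge> 0" "a x = 0 \<longleftrightarrow> x = 0" and am: "a (x * y) = a x * a y" for x y
    using a by (auto simp: absolute_value_def)
  have a1: "a 1 = 1" using abs_one[OF field_type_ring a] by simp
  have ap: "a (x ^ n) = a x ^ n" for x n by (induction n) (simp_all add: am a1)
  have "x \<in> R * R'" for x
  proof -
    obtain n where n: "a x < a b ^ n" using real_arch_pow[OF b(2)] by blast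
    have "b \<noteq> 0" using a0(2)[of b] b(2) by auto
    have "a (x / b ^ n) * a (b ^ n) = a x" using am[of "x / b ^ n" "b ^ n"] \<open>b \<noteq> 0\<close> by simp
    then have "a (x / b ^ n) * a b ^ n \<le> 1 * a b ^ n" using n by (simp add: ap)
    moreover have "a b ^ n > 0" using b(2) by simp
    ultimately have "a (x / b ^ n) \<le> 1" by (simp only: mult_le_cancel_right)
    then have "x / b ^ n * b ^ n \<in> R * R'"
      using O unit_ball.power[OF R' b(1)] by (intro set_times_intro) auto
    then show ?thesis using \<open>b \<noteq> 0\<close> by simp
  qed
  then show ?thesis by blast
qed

text \<open>Let \<open>y\<close> in \<open>R\<close> be at least 1. If a power of \<open>y\<close>
  exceeded 2, then \<open>2 = y ^ n * (2 / y ^ n)\<close> would lie in the product; hence all powers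
  are at most 2 and \<open>y - 1\<close> is infinitesimal. This is applied to \<open>x\<close> or to
  \<open>- x\<close>.\<close>

lemma infinitesimal_shift:
  assumes D: "positive_cone D" and R: "unit_ball R" and two: "2 \<notin> R * positive_cone.interval D"
    and x: "x \<in> R" "x \<notin> positive_cone.interval D"
  obtains s where "s \<in> positive_cone.interval D" "x \<noteq> s"
    "\<And>n. 2 ^ n * (x - s) \<in> positive_cone.interval D"
proof -
  interpret D: positive_cone D by fact
  interpret R: unit_ball R by fact
  interpret I: unit_ball D.interval by (rule D.unit_ball_interval)
  have *: "2 ^ n * (y - 1) \<in> D.interval" if y: "y \<in> R" "y \<noteq> 0" "y - 1 \<in> D" for y n
  proof (rule D.infinitesimal[OF y(3)])
    fix n
    show "2 - y ^ n \<in> D"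
    proof (rule ccontr)
      assume "2 - y ^ n \<notin> D"
      then have "y ^ n - 2 \<in> D" using D.total[of "2 - y ^ n"] by simp
      then have "2 / y ^ n \<in> D.interval" using y D.two by (intro D.inverse_interval) auto
      then have "y ^ n * (2 / y ^ n) \<in> R * D.interval" by (intro set_times_intro R.power y)
      then show False using two y by simp
    qed
  qed
  have "x \<noteq> 0" using x I.zero by auto
  show ?thesis
  proof (cases "x - 1 \<in> D")
    case True
    show ?thesis
      by (rule that[of 1]) (use *[OF x(1) \<open>x \<noteq> 0\<close> True] x I.one in auto)
  next
    case False
    then have "- x - 1 \<in> D" using D.notin_interval[OF x(2)] by blast
    then have 1: "2 ^ n * (- x - 1) \<in> D.interval" for n
      using *[of "- x"] R.uminus[OF x(1)] \<open>x \<noteq> 0\<close> by simp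
    have "2 ^ n * (x - - 1) \<in> D.interval" for n
    proof -
      have "- (2 ^ n * (- x - 1)) = 2 ^ n * (x - - 1)" by (simp add: algebra_simps)
      then show ?thesis using I.uminus[OF 1[of n]] by (simp only:)
    qed
    then show ?thesis
      by (intro that[of "- 1"]) (use x I.minus_one in auto)
  qed
qed

text \<open>Adjoining 2 to the product of two interval balls makes it a ring, which then bounds the
  finest common coarsening from above.\<close>

definition dyadic_hull :: "'a::field set \<Rightarrow> 'a set" where
  "dyadic_hull M = (\<Union>n::nat. (*) (2 ^ n) ` M)"

lemma dyadic_hull:
  assumes M: "unit_ball M"
  shows "unit_ball (dyadic_hull M)" "M \<subseteq> dyadic_hull M" "2 \<in> dyadic_hull M"
proof -
  interpret M: unit_ball M by fact
  show sub: "M \<subseteq> dyadic_hull M"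
    by (auto simp: dyadic_hull_def intro!: exI[of _ 0] image_eqI)
  show "2 \<in> dyadic_hull M"
    using M.one by (auto simp: dyadic_hull_def intro!: exI[of _ 1] image_eqI[of _ _ 1])
  show "unit_ball (dyadic_hull M)"
  proof
    show "a \<in> dyadic_hull M \<or> inverse a \<in> dyadic_hull M" for a
      using M.total[of a] sub by blast
    fix a b assume "a \<in> dyadic_hull M" "b \<in> dyadic_hull M"
    then obtain k l c e where "a = 2 ^ k * c" "b = 2 ^ l * e" "c \<in> M" "e \<in> M"
      by (auto simp: dyadic_hull_def)
    then show "a * b \<in> dyadic_hull M"
      using M.mult[of c e]
      by (auto simp: dyadic_hull_def power_add intro!: exI[of _ "k + l"] image_eqI[of _ _ "c * e"])
  qed
qed

text \<open>If \<open>inverse y = 2 ^ k * c\<close> with \<open>c\<close> in \<open>M\<close>, then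
  \<open>2 = 2 ^ (k + 1) * y * c\<close> would lie in \<open>M\<close>.\<close>

lemma infinitesimal_nonunit:
  assumes M: "unit_ball M" and two: "2 \<notin> M" and y: "\<And>n. 2 ^ n * y \<in> M" "(2::'a::field) \<noteq> 0"
  shows "(y::'a) \<in> nonunits (dyadic_hull M)"
proof (rule ccontr)
  assume "y \<notin> nonunits (dyadic_hull M)"
  then obtain k c where k: "y \<noteq> 0" "inverse y = 2 ^ k * c" "c \<in> M"
    by (auto simp: nonunits_def dyadic_hull_def)
  have "2 ^ Suc k * y * c \<in> M" by (intro unit_ball.mult[OF M] y k)
  moreover have "2 ^ Suc k * y * c = 2 * (y * inverse y)" by (simp only: k(2)) simp
  then have "2 ^ Suc k * y * c = 2" using k(1) by simp
  ultimately show False using two by (simp only:)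
qed

text \<open>Both balls have the same image in the residue field, so the two definite descriptions
  have the same body.\<close>

lemma induced_locality_eq:
  fixes u v w :: "'a::field locality"
  assumes u: "u \<in> localities type_ring"
    and add: "\<And>a b. a \<in> loc_O type_ring u \<Longrightarrow> b \<in> loc_O type_ring u \<Longrightarrow> a + b \<in> loc_O type_ring u"
    and vw: "\<And>x. x \<in> loc_O type_ring v \<Longrightarrow> \<exists>s\<in>loc_O type_ring w. x - s \<in> loc_m type_ring u"
    and wv: "\<And>x. x \<in> loc_O type_ring w \<Longrightarrow> \<exists>s\<in>loc_O type_ring v. x - s \<in> loc_m type_ring u"
  shows "induced_locality type_ring u v = induced_locality type_ring u w"
proof -
  let ?m = "loc_m type_ring u"
  define c where "c x = ?m +>\<^bsub>valuation_subring type_ring u\<^esub> x" for x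
  have c: "c x = {h + x | h. h \<in> ?m}" for x
    by (auto simp: c_def a_r_coset_def' valuation_subring_def)
  have m_add: "a + b \<in> ?m" if "a \<in> ?m" "b \<in> ?m" for a b
    using that nonunits_add[OF _ add] locality_unit_ball[OF u] by simp
  have m_uminus: "- a \<in> ?m" if "a \<in> ?m" for a
    using unit_ball.nonunits_mult[of "loc_O type_ring u" a "- 1"] unit_ball.minus_one[of "loc_O type_ring u"] that
      locality_unit_ball[OF u] by simp
  have sub: "c x \<subseteq> c s" if "x - s \<in> ?m" for x s
  proof
    fix y assume "y \<in> c x"
    then obtain h where "h \<in> ?m" "y = h + x" by (auto simp: c)
    then have "h + (x - s) \<in> ?m" "y = (h + (x - s)) + s" using m_add that by auto
    then show "y \<in> c s" unfolding c by blast
  qed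
  have eq: "c x = c s" if "x - s \<in> ?m" for x s
    using sub[OF that] sub[of s x] m_uminus[OF that] by simp
  have "c ` loc_O type_ring v = c ` loc_O type_ring w"
  proof
    show "c ` loc_O type_ring v \<subseteq> c ` loc_O type_ring w"
      using vw eq by (metis image_eqI image_subsetI)
    show "c ` loc_O type_ring w \<subseteq> c ` loc_O type_ring v"
      using wv eq by (metis image_eqI image_subsetI)
  qed
  then show ?thesis unfolding induced_locality_def c_def by simp
qed

text \<open>
  If \<open>2\<close> were not in the product of the two balls, every element of one ball outside the other
  would differ from \<open>1\<close> or \<open>-1\<close> by an infinitesimal, so that both orderings would induce the
  same ordering on the residue field of their finest common coarsening.
\<close>

lemma two_mem_product_orderings:
  fixes v w :: "'a::field locality"
  assumes v: "v \<in> localities type_ring" "positive_cone C" "loc_O type_ring v = positive_cone.interval C"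
    and w: "w \<in> localities type_ring" "positive_cone D" "loc_O type_ring w = positive_cone.interval D"
    and strong: "strongly_incomparable type_ring v w"
  shows "2 \<in> loc_O type_ring v * loc_O type_ring w"
proof (rule ccontr)
  let ?V = "loc_O type_ring v" and ?W = "loc_O type_ring w"
  let ?M = "?V * ?W"
  assume two: "2 \<notin> ?M"
  interpret C: positive_cone C by fact
  interpret D: positive_cone D by fact
  note V = locality_unit_ball(1)[OF v(1)] and W = locality_unit_ball(1)[OF w(1)]
  note M = unit_ball_product[OF V W]
  have two': "2 \<notin> ?W * ?V" using two by (simp add: mult.commute)
  obtain u where u: "finest_common_coarsening type_ring v w u"
    and neq: "induced_locality type_ring u v \<noteq> induced_locality type_ring u w"
    and inc: "\<not> ?V \<subseteq> ?W" "\<not> ?W \<subseteq> ?V"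
    using strong unfolding strongly_incomparable_def incomparable_def is_refinement_def by blast
  let ?U = "loc_O type_ring u"
  have uloc: "u \<in> localities type_ring" and VU: "?V \<subseteq> ?U" and WU: "?W \<subseteq> ?U"
    using u by (auto simp: finest_common_coarsening_def is_refinement_def)
  note U = locality_unit_ball[OF uloc]
  note N = dyadic_hull[OF M(1)]
  have N_add: "a + b \<in> dyadic_hull ?M" if "a \<in> dyadic_hull ?M" "b \<in> dyadic_hull ?M" for a b
    by (rule coarsening_add_closed[OF V N(1) _ C.two_nonzero N(3) _ that])
      (use N(2) M(2) C.interval_add v(3) in auto)
  have UN: "?U \<subseteq> dyadic_hull ?M"
    using finest_common_coarsening_subset[OF u N(1) N_add] M N by blast
  then have mN: "nonunits (dyadic_hull ?M) \<subseteq> nonunits ?U" by (auto simp: nonunits_def)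
  \<comment> \<open>The nonzero infinitesimal \<open>x - s\<close> will exclude that 2 has value
    above 1 if \<open>u\<close> is an absolute value.\<close>
  obtain x where x: "x \<in> ?V" "x \<notin> ?W" using inc by blast
  obtain s where s: "x \<noteq> s" "\<And>n. 2 ^ n * (x - s) \<in> ?W"
    using infinitesimal_shift[OF w(2) V two[unfolded w(3)] x(1) x(2)[unfolded w(3)]] w(3) by metis
  \<comment> \<open>If \<open>u\<close> were an ordering, both intervals would equal that of
    \<open>u\<close>, against incomparability. For an absolute value, the value of 2 is at most 1
    and \<open>coarsening_add_closed\<close> applies.\<close>
  have U_add: "a + b \<in> ?U" if "a \<in> ?U" "b \<in> ?U" for a b
    using uloc
  proof (cases rule: locality_cases)
    case ring
    then show ?thesis using that by blast
  next
    case (ordering E)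
    then have "?V = ?U" "?W = ?U"
      using interval_subset_eq[OF v(2) ordering(1)] interval_subset_eq[OF w(2) ordering(1)]
        VU WU v(3) w(3) by simp_all
    then show ?thesis using inc by simp
  next
    case (absolute a)
    have a0: "a y \<ge> 0" "a y = 0 \<longleftrightarrow> y = 0" and am: "a (y * z) = a y * a z" for y z
      using absolute(1) by (auto simp: absolute_value_def)
    have "a 1 = 1" using abs_one[OF field_type_ring absolute(1)] by simp
    then have ap: "a (y ^ n) = a y ^ n" for y n by (induction n) (simp_all add: am)
    have "a 2 \<le> 1"
    proof (rule ccontr)
      assume "\<not> a 2 \<le> 1"
      then obtain n where n: "inverse (a (x - s)) < a 2 ^ n"
        using real_arch_pow[of "a 2"] by auto
      have pos: "a (x - s) > 0" using a0[of "x - s"] s(1) by (simp add: less_le)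
      have "a 2 ^ n * a (x - s) \<le> 1"
        using s(2)[of n] WU absolute(2) by (auto simp: am ap)
      then show False using n pos by (simp add: field_simps)
    qed
    then have "2 \<in> ?U" using absolute(2) by simp
    then show ?thesis
      using coarsening_add_closed[OF V U(1) VU C.two_nonzero _ _ that] C.interval_add v(3) by simp
  qed
  have m: "loc_m type_ring u = nonunits ?U" by (rule U(2))
  \<comment> \<open>Stated for abstract \<open>X'\<close> and \<open>Y\<close> because it is applied
    in both directions between the two balls.\<close>
  have close: "\<exists>s\<in>Y. x - s \<in> loc_m type_ring u"
    if x: "x \<in> X'" and X': "unit_ball X'" and E: "positive_cone E" "Y = positive_cone.interval E"
      and t: "2 \<notin> X' * Y" and MY: "X' * Y = ?M" for x X' Y E
  proof (cases "x \<in> Y")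
    case True
    then show ?thesis using m by (intro bexI[of _ x]) (auto simp: nonunits_def)
  next
    case False
    obtain s where s: "s \<in> Y" "\<And>n. 2 ^ n * (x - s) \<in> Y"
      using infinitesimal_shift[OF E(1) X' t[unfolded E(2)] x False[unfolded E(2)]] E(2) by metis
    have "Y \<subseteq> ?M"
      using unit_ball_product(3)[OF X', of Y] positive_cone.unit_ball_interval[OF E(1)] E(2) MY by simp
    then have "x - s \<in> nonunits (dyadic_hull ?M)"
      using s(2) by (intro infinitesimal_nonunit[OF M(1) two _ C.two_nonzero]) auto
    then show ?thesis using s(1) mN m by auto
  qed
  have "induced_locality type_ring u v = induced_locality type_ring u w"
  proof (rule induced_locality_eq[OF uloc U_add])
    show "\<exists>s\<in>?W. x - s \<in> loc_m type_ring u" if "x \<in> ?V" for x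
      using close[OF that V w(2,3) two] by simp
    show "\<exists>s\<in>?V. x - s \<in> loc_m type_ring u" if "x \<in> ?W" for x
      using close[OF that W v(2,3) two'] by (simp add: mult.commute)
  qed
  with neq show False by blast
qed

text \<open>Once the product is closed under addition it is a common coarsening, so it contains the
  ball of \<open>u\<close>, where \<open>t\<close> is a unit. Additive closure comes from a ring
  among the factors, from an absolute value (the product is everything), or for two orderings from
  \<open>2\<close> lying in the product.\<close>

lemma t_independent_product:
  fixes v w :: "'a::field locality"
  defines "V \<equiv> loc_O type_ring v" and "W \<equiv> loc_O type_ring w"
  assumes vw: "v \<in> localities type_ring" "w \<in> localities type_ring"
    and ind: "t_independent type_ring t v w" and t: "t \<noteq> 0"
    and addV: "\<And>a b. a \<in> V \<Longrightarrow> b \<in> V \<Longrightarrow> t * (a + b) \<in> V"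
    and addW: "\<And>a b. a \<in> W \<Longrightarrow> b \<in> W \<Longrightarrow> t * (a + b) \<in> W"
  shows "(\<forall>a\<in>V * W. \<forall>b\<in>V * W. a + b \<in> V * W) \<and> inverse t \<in> V * W"
proof -
  note V = locality_unit_ball(1)[OF vw(1), folded V_def]
    and W = locality_unit_ball(1)[OF vw(2), folded W_def]
  note M = unit_ball_product[OF V W]
  obtain u where u: "finest_common_coarsening type_ring v w u"
    and tu: "t \<in> loc_O type_ring u - loc_m type_ring u"
    using ind unfolding t_independent_def by blast
  have "u \<in> localities type_ring" using u by (simp add: finest_common_coarsening_def)
  then have T: "inverse t \<in> loc_O type_ring u"
    using tu locality_unit_ball(2) by (auto simp: nonunits_def)
  have ring_case: "a + b \<in> V * W"
    if "X' = V \<or> X' = W" "\<And>a b. a \<in> X' \<Longrightarrow> b \<in> X' \<Longrightarrow> inverse c * (a + b) \<in> X'"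
      "c \<noteq> 0" "c \<in> V * W" "a \<in> V * W" "b \<in> V * W" for X' c a b
    using coarsening_add_closed[of X' "V * W" c a b] that M V W by blast
  have add: "a + b \<in> V * W" if ab: "a \<in> V * W" "b \<in> V * W" for a b
  proof (cases "V \<subseteq> W \<or> W \<subseteq> V")
    case True
    \<comment> \<open>The larger of two comparable balls belongs to a common coarsening, so it
      contains the ball of \<open>u\<close> and with it \<open>inverse t\<close>.\<close>
    then have "inverse t \<in> V * W"
    proof
      assume "V \<subseteq> W"
      then have "loc_O type_ring u \<subseteq> W"
        using u vw(2) unfolding finest_common_coarsening_def is_refinement_def V_def W_def by blast
      then show ?thesis using T M by blast
    next
      assume "W \<subseteq> V"
      then have "loc_O type_ring u \<subseteq> V"
        using u vw(1) unfolding finest_common_coarsening_def is_refinement_def V_def W_def by blast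
      then show ?thesis using T M by blast
    qed
    then show ?thesis using ring_case[of V "inverse t"] addV t ab by simp
  next
    case False
    have ringD: "a + b \<in> V * W" if "X' = V \<or> X' = W" "\<And>a b. a \<in> X' \<Longrightarrow> b \<in> X' \<Longrightarrow> a + b \<in> X'" for X'
      using ring_case[OF that(1), of 1] that(2) ab unit_ball.one[OF M(1)] by simp
    show ?thesis
      using vw(1)
    proof (cases rule: locality_cases)
      case ring
      then show ?thesis using ringD[of V] by (simp add: V_def)
    next
      case (absolute a)
      then have "V * W = UNIV" using product_eq_UNIV[OF absolute(1) _ W] False by (simp add: V_def)
      then show ?thesis by simp
    next
      case C: (ordering C)
      show ?thesis
        using vw(2)
      proof (cases rule: locality_cases)
        case ring
        then show ?thesis using ringD[of W] by (simp add: W_def)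
      next
        case (absolute a)
        then have "W * V = UNIV" using product_eq_UNIV[OF absolute(1) _ V] False by (simp add: W_def)
        then show ?thesis by (simp add: mult.commute)
      next
        case (ordering D)
        have "strongly_incomparable type_ring v w"
          using ind C(3) ordering(3) by (simp add: t_independent_def)
        then have "2 \<in> V * W"
          using two_mem_product_orderings[OF vw(1) C(1,2) vw(2) ordering(1,2)] by (simp add: V_def W_def)
        then show ?thesis
          using ring_case[of V 2 a b] C(2) ab positive_cone.interval_add[OF C(1)]
            positive_cone.two_nonzero[OF C(1)] by (simp add: V_def)
      qed
    qed
  qed
  have "loc_O type_ring u \<subseteq> V * W"
    using finest_common_coarsening_subset[OF u M(1) add] M by (simp add: V_def W_def)
  then show ?thesis using add T by blast
qed

section \<open>Gluing over finitely many classes\<close>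

context approximation_family
begin

text \<open>Induction over the values of \<open>g\<close>, gluing one class at a time. A single
  class is solved by its common value of \<open>x\<close>, since 0 lies in every
  \<open>B p\<close>.\<close>

lemma solvable_classes:
  fixes g :: "'p \<Rightarrow> 'i"
  assumes C: "C \<subseteq> P" and fin: "finite (g ` C)"
    and same: "\<And>p q. p \<in> C \<Longrightarrow> q \<in> C \<Longrightarrow> g p = g q \<Longrightarrow> x p = x q"
    and compat: "\<And>p q. p \<in> C \<Longrightarrow> q \<in> C \<Longrightarrow> g p \<noteq> g q \<Longrightarrow> compatible p q"
    and cover: "\<And>j. coverable {p \<in> C. g p = j}"
    and comb: "\<And>D l. D \<subseteq> C \<Longrightarrow> combinable D l"
    and bump: "\<And>D E. D \<subseteq> C \<Longrightarrow> E \<subseteq> C \<Longrightarrow> bumpable D E"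
  shows "solvable C \<and> coverable C"
proof -
  have cover': "coverable {p \<in> C. g p \<in> J}" if J: "finite J" for J
  proof -
    have eq: "{p \<in> C. g p \<in> J} = (\<Union>j\<in>J. {p \<in> C. g p = j})" by auto
    have "finite_subcover {p \<in> C. g p = j} (\<lambda>p w. a * w \<in> B p \<and> b / z p * w \<in> B p)" for j a b
      using cover[of j] unfolding coverable_def by blast
    then show ?thesis
      unfolding eq coverable_def by (intro allI finite_subcover_UN J)
  qed
  have "solvable {p \<in> C. g p \<in> J}" if "finite J" for J
    using that
  proof (induction J rule: finite_induct)
    case empty
    then show ?case by (simp add: solvable_def)
  next
    case (insert j J)
    have eq: "{p \<in> C. g p \<in> insert j J} = {p \<in> C. g p \<in> J} \<union> {p \<in> C. g p = j}" by auto
    have "solvable {p \<in> C. g p = j}"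
      unfolding solvable_def
    proof
      fix k
      show "\<exists>y. \<forall>p\<in>{p \<in> C. g p = j}. (y - x p) / (t ^ k * z p) \<in> B p"
      proof (cases "\<exists>q\<in>C. g q = j")
        case True
        then obtain q where q: "q \<in> C" "g q = j" by blast
        have "x p = x q" if "p \<in> C" "g p = j" for p using same[OF that(1) q(1)] that q by simp
        then show ?thesis using C B_zero by (intro exI[of _ "x q"]) auto
      qed blast
    qed
    moreover have "compatible p q" if "p \<in> {p \<in> C. g p \<in> J}" "q \<in> {p \<in> C. g p = j}" for p q
      using that insert.hyps(2) by (intro compat) auto
    ultimately show ?case
      unfolding eq using C insert
      by (intro solvable_Un cover' cover comb bump) auto
  qed
  from this[OF fin] cover'[OF fin] have "solvable {p \<in> C. g p \<in> g ` C}" "coverable {p \<in> C. g p \<in> g ` C}" .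
  moreover have "{p \<in> C. g p \<in> g ` C} = C" by auto
  ultimately show ?thesis by simp
qed

end

text \<open>One point is kept for each minimal value of \<open>g\<close>: a new point is skipped if
  something kept lies below it, and otherwise replaces whatever lies above it.\<close>

lemma finite_antichain_below:
  fixes g :: "'p \<Rightarrow> 'a set"
  assumes "finite F"
  obtains F' where "F' \<subseteq> F" "\<And>p. p \<in> F \<Longrightarrow> \<exists>q\<in>F'. g q \<subseteq> g p"
    "\<And>p q. p \<in> F' \<Longrightarrow> q \<in> F' \<Longrightarrow> p \<noteq> q \<Longrightarrow> \<not> g p \<subseteq> g q"
proof -
  have "\<exists>F'\<subseteq>F. (\<forall>p\<in>F. \<exists>q\<in>F'. g q \<subseteq> g p) \<and> (\<forall>p\<in>F'. \<forall>q\<in>F'. p \<noteq> q \<longrightarrow> \<not> g p \<subseteq> g q)"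
    using assms
  proof (induction F rule: finite_induct)
    case empty
    then show ?case by simp
  next
    case (insert a F)
    from insert.IH obtain F' where F': "F' \<subseteq> F" "\<forall>p\<in>F. \<exists>q\<in>F'. g q \<subseteq> g p"
      "\<forall>p\<in>F'. \<forall>q\<in>F'. p \<noteq> q \<longrightarrow> \<not> g p \<subseteq> g q" by (elim exE conjE)
    show ?case
    proof (cases "\<exists>q\<in>F'. g q \<subseteq> g a")
      case True
      with F' show ?thesis by (intro exI[of _ F']) auto
    next
      case False
      let ?F = "insert a {q \<in> F'. \<not> g a \<subseteq> g q}"
      have "\<exists>q\<in>?F. g q \<subseteq> g p" if p: "p \<in> insert a F" for p
      proof (cases "p = a")
        case False
        then obtain q where "q \<in> F'" "g q \<subseteq> g p" using p F'(2) by blast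
        then show ?thesis by (cases "g a \<subseteq> g q") auto
      qed auto
      moreover have "?F \<subseteq> insert a F" using F'(1) by auto
      moreover have "\<forall>p\<in>?F. \<forall>q\<in>?F. p \<noteq> q \<longrightarrow> \<not> g p \<subseteq> g q" using F'(3) False by auto
      ultimately have "?F \<subseteq> insert a F \<and> (\<forall>p\<in>insert a F. \<exists>q\<in>?F. g q \<subseteq> g p) \<and>
          (\<forall>p\<in>?F. \<forall>q\<in>?F. p \<noteq> q \<longrightarrow> \<not> g p \<subseteq> g q)"
        by (intro conjI ballI[of "insert a F"])
      then show ?thesis by (rule exI)
    qed
  qed
  then obtain F' where F': "F' \<subseteq> F" "\<forall>p\<in>F. \<exists>q\<in>F'. g q \<subseteq> g p"
    "\<forall>p\<in>F'. \<forall>q\<in>F'. p \<noteq> q \<longrightarrow> \<not> g p \<subseteq> g q" by (elim exE conjE)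
  show ?thesis by (rule that[of F']) (use F' in auto)
qed

lemma finite_subcover_image:
  assumes "finite_subcover A (\<lambda>v. Pr (h v))"
  shows "finite_subcover (h ` A) Pr"
  unfolding finite_subcover_def
proof (intro allI impI)
  fix Q assume "\<forall>p\<in>h ` A. \<exists>x\<in>Q. Pr p x"
  then obtain Q' where "finite Q'" "Q' \<subseteq> Q" "\<forall>v\<in>A. \<exists>x\<in>Q'. Pr (h v) x"
    using finite_subcoverD[OF assms, of Q] by auto
  then show "\<exists>Q'. finite Q' \<and> Q' \<subseteq> Q \<and> (\<forall>p\<in>h ` A. \<exists>x\<in>Q'. Pr p x)" by auto
qed

lemma finite_subcover_compactin:
  assumes A: "compactin T A" and op: "\<And>w. openin T {v \<in> topspace T. Pr v w}"
  shows "finite_subcover A Pr"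
  unfolding finite_subcover_def
proof (intro allI impI)
  fix Q assume Q: "\<forall>p\<in>A. \<exists>x\<in>Q. Pr p x"
  define U where "U w = {v \<in> topspace T. Pr v w}" for w
  have AT: "A \<subseteq> topspace T" using A by (rule compactin_subset_topspace)
  have "A \<subseteq> \<Union> (U ` Q)" using Q AT by (auto simp: U_def)
  moreover have "\<forall>V\<in>U ` Q. openin T V" using op by (auto simp: U_def)
  ultimately obtain F where "finite F" "F \<subseteq> U ` Q" "A \<subseteq> \<Union> F"
    using A unfolding compactin_def by meson
  then obtain Q' where "finite Q'" "Q' \<subseteq> Q" "F = U ` Q'" by (metis finite_subset_image)
  with \<open>A \<subseteq> \<Union> F\<close> show "\<exists>Q'. finite Q' \<and> Q' \<subseteq> Q \<and> (\<forall>p\<in>A. \<exists>x\<in>Q'. Pr p x)"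
    by (intro exI[of _ Q']) (auto simp: U_def)
qed

lemma openin_loc_topology:
  "openin (loc_topology sit (type_ring :: 'a::field ring))
     {v \<in> topspace (loc_topology sit type_ring). a \<in> frakB sit type_ring v}"
proof -
  let ?X = "\<lambda>a. {v \<in> localities type_ring. a \<in> frakB sit type_ring v}"
  have T: "loc_topology sit (type_ring :: 'a ring) = topology_generated_by {?X a | a. True}"
    by (cases sit) (simp_all add: Zar_def Zar_star_def)
  have "openin (loc_topology sit type_ring) (?X a)"
    unfolding T by (rule topology_generated_by_Basis) blast
  then have "openin (loc_topology sit type_ring) (topspace (loc_topology sit type_ring) \<inter> ?X a)"
    by blast
  moreover have "topspace (loc_topology sit (type_ring :: 'a ring)) \<subseteq> localities type_ring"
    unfolding T topology_generated_by_topspace by auto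
  then have "topspace (loc_topology sit type_ring) \<inter> ?X a
      = {v \<in> topspace (loc_topology sit type_ring). a \<in> frakB sit type_ring v}" by auto
  ultimately show ?thesis by simp
qed

section \<open>The approximation theorem\<close>

theorem theorem6p4:
  fixes K :: "'a::field ring"
    and sit :: situation
    and n :: nat
    and S :: "nat \<Rightarrow> 'a locality set"
    and t :: 'a
    and x z :: "nat \<Rightarrow> 'a"
  assumes K: "K = ring_of_type_algebra"
    and S: "\<forall>i\<in>{1..n}. S i \<subseteq> localities K"
    and t: "t \<noteq> 0"
    and z: "\<forall>i\<in>{1..n}. z i \<noteq> 0"
    and U: "\<exists>f :: 'a poly. \<exists>d. Polynomial.degree f = d \<and> d \<ge> 2 \<and>
      (\<forall>v\<in>(\<Union>i\<in>{1..n}. S i).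
         (\<forall>y\<in>loc_O K v. poly f y \<in> loc_O K v) \<and>
         (\<forall>y. y \<notin> loc_O K v \<longrightarrow>
            poly f y \<in> (y ^ d *o (loc_O K v - t *o loc_m K v))
                       \<inter> ((Polynomial.coeff f d * y ^ d) +o (y ^ (d - 1) *o loc_O K v))) \<and>
         loc_O K v + loc_O K v \<subseteq> inverse t *o loc_O K v) \<and>
      (\<forall>i\<in>{1..n}. infinite (S i) \<longrightarrow>
         (\<forall>v\<in>S i. \<forall>y\<in>loc_O K v. poly f y \<notin> t *o loc_m K v))"
    and T: "\<forall>i\<in>{1..n}. compactin (loc_topology sit K) (S i)"
    and I_values: "\<forall>i\<in>{1..n}. \<forall>j\<in>{1..n}. \<forall>\<Gamma> r w.
      krull_valuation K \<Gamma> r w \<and>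
      (\<exists>v\<in>S i. is_refinement K v (locality_of K (Valuation \<Gamma> r w))) \<and>
      (\<exists>v\<in>S j. is_refinement K v (locality_of K (Valuation \<Gamma> r w))) \<longrightarrow>
      val_le r (w (z i)) (w (x i - x j)) \<and> w (z i) = w (z j)"
    and I_independent: "\<forall>i\<in>{1..n}. \<forall>j\<in>{1..n}. i \<noteq> j \<longrightarrow>
      (\<forall>v\<in>S i. \<forall>w\<in>S j. t_independent K t v w)"
    and I_incomparable: "sit = Situation_m \<longrightarrow>
      (\<forall>i\<in>{1..n}. \<forall>j\<in>{1..n}. i \<noteq> j \<longrightarrow> (\<forall>v\<in>S i. \<forall>w\<in>S j. incomparable K v w))"
  shows "\<exists>y. \<forall>i\<in>{1..n}. \<forall>v\<in>S i. y - x i \<in> z i *o frakB sit K v"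
proof -
  note z_nonzero = z
  \<comment> \<open>Points are pairs \<open>(i, v)\<close>, since \<open>v\<close> may lie in several \<open>S i\<close>. On finite \<open>S i\<close>
    the stronger condition with \<open>m\<close> in place of \<open>O\<close> is solved in both situations.\<close>
  define P where "P = (SIGMA i:{1..n}. S i)"
  define R where "R p = loc_O K (snd p)" for p :: "nat \<times> 'a locality"
  define B where "B p = (if infinite (S (fst p)) then frakB sit K (snd p) else loc_m K (snd p))"
    for p :: "nat \<times> 'a locality"
  define xx where "xx p = x (fst p)" for p :: "nat \<times> 'a locality"
  define zz where "zz p = z (fst p)" for p :: "nat \<times> 'a locality"
  have memP: "fst p \<in> {1..n}" "snd p \<in> S (fst p)" if "p \<in> P" for p
    using that by (auto simp: P_def)
  have loc: "snd p \<in> localities type_ring" if "p \<in> P" for p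
    using memP[OF that] S K by blast
  have ball: "unit_ball (R p)" and m: "loc_m K (snd p) = nonunits (R p)" if "p \<in> P" for p
    using locality_unit_ball[OF loc[OF that]] K by (simp_all add: R_def)
  have frakB: "frakB sit K (snd p) = R p \<or> frakB sit K (snd p) = nonunits (R p)" if "p \<in> P" for p
    using m[OF that] by (cases sit) (simp_all add: R_def)
  have B: "B p = R p \<or> B p = nonunits (R p)" if "p \<in> P" for p
    using m[OF that] frakB[OF that] by (simp add: B_def)
  obtain f :: "'a poly" and d where d: "d \<ge> 2"
    and f1: "\<forall>v\<in>(\<Union>i\<in>{1..n}. S i). \<forall>y\<in>loc_O K v. poly f y \<in> loc_O K v"
    and f2: "\<forall>v\<in>(\<Union>i\<in>{1..n}. S i). \<forall>y. y \<notin> loc_O K v \<longrightarrow>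
            poly f y \<in> (y ^ d *o (loc_O K v - t *o loc_m K v))
                       \<inter> ((Polynomial.coeff f d * y ^ d) +o (y ^ (d - 1) *o loc_O K v))"
    and f3: "\<forall>v\<in>(\<Union>i\<in>{1..n}. S i). loc_O K v + loc_O K v \<subseteq> inverse t *o loc_O K v"
    and f4: "\<forall>i\<in>{1..n}. infinite (S i) \<longrightarrow>
         (\<forall>v\<in>S i. \<forall>y\<in>loc_O K v. poly f y \<notin> t *o loc_m K v)"
    using U by blast
  have memU: "snd p \<in> (\<Union>i\<in>{1..n}. S i)" if "p \<in> P" for p using memP[OF that] by blast
  have add: "t * (a + b) \<in> R p" if "p \<in> P" "a \<in> R p" "b \<in> R p" for p a b
  proof -
    have "a + b \<in> inverse t *o R p"
      using f3 memU[OF that(1)] that(2,3) unfolding R_def by blast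
    then show ?thesis using t by (auto simp: elt_set_times_def mult.assoc[symmetric])
  qed
  \<comment> \<open>Turns both the lower bound in (iii) and condition (ii) into bounds on
    inverses.\<close>
  have large: "g \<noteq> 0 \<and> t / g \<in> R p" if p: "p \<in> P" and g: "g \<notin> t *o loc_m K (snd p)" for g p
  proof -
    have "g / t \<notin> nonunits (R p)"
      using g t m[OF p] by (auto simp: elt_set_times_def)
    then show ?thesis using t by (auto simp: nonunits_def)
  qed
  have balls: "ball_family P R B t"
    by (intro ball_family.intro t ball add B)
  interpret approximation_family P R B t xx zz
    by (intro approximation_family.intro balls approximation_family_axioms.intro)
      (use memP z in \<open>auto simp: zz_def\<close>)
  interpret F: polynomial_ball_family P R B t f d
  proof (intro polynomial_ball_family.intro balls polynomial_ball_family_axioms.intro d)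
    show "poly f y \<in> R p" if "p \<in> P" "y \<in> R p" for p y
      using f1 memU[OF that(1)] that(2) unfolding R_def by blast
  next
    fix p y assume p: "p \<in> P" and y: "y \<notin> R p"
    have "y \<noteq> 0" using unit_ball.zero[OF ball[OF p]] y by auto
    have fy: "poly f y \<in> y ^ d *o (R p - t *o loc_m K (snd p))"
      "poly f y \<in> (Polynomial.coeff f d * y ^ d) +o (y ^ (d - 1) *o R p)"
      using f2 memU[OF p] y unfolding R_def by blast+
    obtain g where g: "poly f y = y ^ d * g" "g \<in> R p" "g \<notin> t *o loc_m K (snd p)"
      using fy(1) by (auto simp: elt_set_times_def)
    then show "poly f y \<noteq> 0 \<and> poly f y / y ^ d \<in> R p \<and> t * y ^ d / poly f y \<in> R p"
      using large[OF p g(3)] \<open>y \<noteq> 0\<close> by simp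
    show "(poly f y - Polynomial.coeff f d * y ^ d) / y ^ (d - 1) \<in> R p"
      using fy(2) \<open>y \<noteq> 0\<close> by (auto simp: elt_set_times_def elt_set_plus_def)
  qed

  have product: "(\<forall>a\<in>R p * R q. \<forall>b\<in>R p * R q. a + b \<in> R p * R q) \<and> inverse t \<in> R p * R q \<and>
      (xx q - xx p) / zz p \<in> R p * R q \<and> zz q / zz p \<in> R p * R q \<and> zz p / zz q \<in> R p * R q"
    if p: "p \<in> P" and q: "q \<in> P" and neq: "fst p \<noteq> fst q" for p q
  proof -
    let ?M = "R p * R q"
    have "t_independent type_ring t (snd p) (snd q)"
      using I_independent memP[OF p] memP[OF q] neq K by blast
    from t_independent_product[OF loc[OF p] loc[OF q] this t]
    have M: "\<forall>a\<in>?M. \<forall>b\<in>?M. a + b \<in> ?M" "inverse t \<in> ?M"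
      using add[OF p] add[OF q] K by (simp_all add: R_def)
    note MM = unit_ball_product[OF ball[OF p] ball[OF q]]
    have M_add: "\<And>a b. a \<in> ?M \<Longrightarrow> b \<in> ?M \<Longrightarrow> a + b \<in> ?M" using M(1) by blast
    \<comment> \<open>The product ring comes with a valuation coarsening both points, to which (I)
      applies; its order is divisibility in the ring.\<close>
    obtain \<Gamma> r w where w: "krull_valuation type_ring \<Gamma> r w"
      "loc_O type_ring (locality_of type_ring (Valuation \<Gamma> r w)) = ?M"
      "\<forall>a b. val_le r (w a) (w b) \<longleftrightarrow> b = 0 \<or> (a \<noteq> 0 \<and> b / a \<in> ?M)"
      by (rule locality_of_ring[OF MM(1) M_add]) auto
    have ref: "is_refinement K (snd p) (locality_of K (Valuation \<Gamma> r w))"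
      "is_refinement K (snd q) (locality_of K (Valuation \<Gamma> r w))"
      using MM w(2) K by (auto simp: is_refinement_def R_def)
    have val: "val_le r (w (zz p)) (w (xx p - xx q)) \<and> w (zz p) = w (zz q)"
      using I_values memP[OF p] memP[OF q] ref w(1) K unfolding xx_def zz_def by blast
    have nz: "zz p \<noteq> 0" "zz q \<noteq> 0" using z p q by blast+
    have "val_le r (w (zz p)) (w (zz p))" using w(3) nz unit_ball.one[OF MM(1)] by simp
    then have "val_le r (w (zz p)) (w (zz q))" "val_le r (w (zz q)) (w (zz p))" using val by simp_all
    then have "zz q / zz p \<in> ?M" "zz p / zz q \<in> ?M" using w(3) nz by blast+
    moreover have "(xx p - xx q) / zz p \<in> ?M"
      using w(3) nz val unit_ball.zero[OF MM(1)] by (cases "xx p = xx q") simp_all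
    then have "- ((xx p - xx q) / zz p) \<in> ?M" by (rule unit_ball.uminus[OF MM(1)])
    then have "(xx q - xx p) / zz p \<in> ?M" by (simp add: minus_divide_left)
    ultimately show ?thesis using M by blast
  qed

  define Pinf where "Pinf = {p \<in> P. infinite (S (fst p))}"
  define Pfin where "Pfin = P - Pinf"
  have "finite Pfin"
  proof (rule finite_subset)
    show "Pfin \<subseteq> (SIGMA i:{i\<in>{1..n}. finite (S i)}. S i)" by (auto simp: Pfin_def Pinf_def P_def)
  qed auto
  have InfB: "B p = frakB sit K (snd p)" if "p \<in> Pinf" for p using that by (simp add: B_def Pinf_def)
  have FinB: "B p = nonunits (R p)" if "p \<in> Pfin" for p
    using that m by (auto simp: B_def Pinf_def Pfin_def)
  have inc: "\<not> R p \<subseteq> R q" if "sit = Situation_m" "p \<in> P" "q \<in> P" "fst p \<noteq> fst q" for p q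
    using I_incomparable that memP[OF that(2)] memP[OF that(3)]
    unfolding incomparable_def is_refinement_def R_def by blast
  have different: "fst p \<noteq> fst q" if "p \<in> Pfin" "q \<in> Pinf" for p q
    using that by (auto simp: Pfin_def Pinf_def)
  \<comment> \<open>Where \<open>B\<close> consists of nonunits, \<open>compatible\<close> demands
    noninclusion of balls. In Situation m this is a hypothesis and all of \<open>Pfin\<close> is
    kept; in Situation O only minimal points not above a point of \<open>Pinf\<close> are
    kept.\<close>
  obtain F' where F': "F' \<subseteq> Pfin"
    and F'_F': "\<And>p q. p \<in> F' \<Longrightarrow> q \<in> F' \<Longrightarrow> fst p \<noteq> fst q \<Longrightarrow> \<not> R p \<subseteq> R q"
    and F'_Pinf: "\<And>p q. p \<in> F' \<Longrightarrow> q \<in> Pinf \<Longrightarrow> \<not> R q \<subseteq> R p"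
    and dropped: "\<And>p. p \<in> Pfin \<Longrightarrow> p \<notin> F' \<Longrightarrow> sit = Situation_O \<and> (\<exists>q\<in>F' \<union> Pinf. R q \<subseteq> R p)"
  proof (cases sit)
    case Situation_m
    show ?thesis
    proof (rule that[of Pfin])
      show "\<not> R q \<subseteq> R p" if "p \<in> Pfin" "q \<in> Pinf" for p q
        using inc[OF Situation_m, of q p] that different[OF that] by (auto simp: Pfin_def Pinf_def)
    qed (use inc[OF Situation_m] in \<open>auto simp: Pfin_def\<close>)
  next
    case Situation_O
    let ?F = "{p \<in> Pfin. \<not> (\<exists>q\<in>Pinf. R q \<subseteq> R p)}"
    have "finite ?F" using \<open>finite Pfin\<close> by simp
    then obtain F' where F': "F' \<subseteq> ?F" "\<And>p. p \<in> ?F \<Longrightarrow> \<exists>q\<in>F'. R q \<subseteq> R p"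
      "\<And>p q. p \<in> F' \<Longrightarrow> q \<in> F' \<Longrightarrow> p \<noteq> q \<Longrightarrow> \<not> R p \<subseteq> R q"
      by (rule finite_antichain_below[of _ R]) blast
    show ?thesis
    proof (rule that[of F'])
      show "\<not> R p \<subseteq> R q" if "p \<in> F'" "q \<in> F'" "fst p \<noteq> fst q" for p q
        using F'(3)[OF that(1,2)] that(3) by auto
      show "sit = Situation_O \<and> (\<exists>q\<in>F' \<union> Pinf. R q \<subseteq> R p)" if "p \<in> Pfin" "p \<notin> F'" for p
        using F'(2)[of p] that Situation_O by blast
    qed (use F'(1) in auto)
  qed

  have sub: "Pinf \<subseteq> P" "F' \<subseteq> P" using F' by (auto simp: Pinf_def Pfin_def)
  have B_Pinf: "B p = R p \<or> \<not> R q \<subseteq> R p" if "p \<in> Pinf" "q \<in> P" "fst p \<noteq> fst q" for p q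
  proof (cases sit)
    case Situation_m
    then show ?thesis using inc[of q p] that sub by auto
  next
    case Situation_O
    then show ?thesis using InfB[OF that(1)] by (simp add: R_def)
  qed
  have fin_fst: "finite (fst ` C)" if "C \<subseteq> P" for C
    by (rule finite_subset[of _ "{1..n}"]) (use that memP in auto)
  have reg: "F.regular p" if "p \<in> Pinf" for p
    using that memP[of p] f4 large[of p] sub(1) unfolding F.regular_def R_def Pinf_def by blast
  have cover_Pinf: "coverable {p \<in> Pinf. fst p = i}" for i
  proof (cases "i \<in> {1..n} \<and> infinite (S i)")
    case True
    have eq: "{p \<in> Pinf. fst p = i} = Pair i ` S i" using True by (auto simp: Pinf_def P_def)
    have "finite_subcover (S i) (\<lambda>v w. a * w \<in> B (i, v) \<and> b / zz (i, v) * w \<in> B (i, v))" for a b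
    \<comment> \<open>Hypothesis (T) enters here; each condition defines an intersection of two
      subbasic open sets.\<close>
    proof (rule finite_subcover_compactin)
      show "compactin (loc_topology sit K) (S i)" using T True by blast
      show "openin (loc_topology sit K) {v \<in> topspace (loc_topology sit K).
              a * w \<in> B (i, v) \<and> b / zz (i, v) * w \<in> B (i, v)}" for w
        using openin_Int[OF openin_loc_topology[of sit "a * w"] openin_loc_topology[of sit "b / z i * w"]]
          True K by (simp add: B_def zz_def Int_def conj_ac cong: conj_cong)
    qed
    then show ?thesis unfolding coverable_def eq by (intro allI finite_subcover_image) auto
  next
    case False
    then have "{p \<in> Pinf. fst p = i} = {}" by (auto simp: Pinf_def P_def)
    then have "finite {p \<in> Pinf. fst p = i}" by (simp only: finite.emptyI)
    then show ?thesis unfolding coverable_def by (intro allI finite_subcover_finite)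
  qed
  have "solvable Pinf \<and> coverable Pinf"
  proof (rule solvable_classes[of Pinf fst])
    show "compatible p q" if "p \<in> Pinf" "q \<in> Pinf" "fst p \<noteq> fst q" for p q
      using product[of p q] B_Pinf[of p q] B_Pinf[of q p] that sub by (auto simp: compatible_def)
    show "combinable D l" if "D \<subseteq> Pinf" for D l
      using that sub reg by (intro F.combinable_regular) auto
    show "bumpable D E" if "D \<subseteq> Pinf" "E \<subseteq> Pinf" for D E
      using that sub reg by (intro F.bumpable_poly) auto
  qed (use sub fin_fst cover_Pinf in \<open>auto simp: xx_def\<close>)
  moreover have "solvable F' \<and> coverable F'"
  proof (rule solvable_classes[of F' fst])
    have fin: "finite D" if "D \<subseteq> F'" for D
      using that F' \<open>finite Pfin\<close> by (meson finite_subset)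
    have BF: "B p = nonunits (R p)" if "p \<in> F'" for p using that F' FinB by blast
    show "compatible p q" if "p \<in> F'" "q \<in> F'" "fst p \<noteq> fst q" for p q
      using product[of p q] F'_F'[of p q] F'_F'[of q p] that sub by (auto simp: compatible_def)
    show "combinable D l" if "D \<subseteq> F'" for D l
      using that sub BF fin[OF that] by (intro combinable_finite) auto
    show "bumpable D E" if "D \<subseteq> F'" "E \<subseteq> F'" for D E
      using that sub BF by (intro bumpable_nonunits) auto
    show "coverable {p \<in> F'. fst p = j}" for j
      unfolding coverable_def by (intro allI finite_subcover_finite fin) blast
  qed (use sub fin_fst in \<open>auto simp: xx_def\<close>)
  ultimately have "solvable (Pinf \<union> F')"
  proof (intro solvable_Un sub)
    show "compatible p q" if "p \<in> Pinf" "q \<in> F'" for p q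
    proof -
      have "fst p \<noteq> fst q" using different[of q p] that F' by auto
      then show ?thesis
        using product[of p q] B_Pinf[of p q] F'_Pinf[of q p] that sub by (auto simp: compatible_def)
    qed
    show "combinable Pinf l" for l using sub reg by (intro F.combinable_regular) auto
    show "combinable F' l" for l
      using sub F' FinB \<open>finite Pfin\<close> by (intro combinable_finite) (auto dest: finite_subset)
    \<comment> \<open>\<open>f\<close> may have zeros in the balls of \<open>F'\<close>, so
      regularity is used on the side of \<open>Pinf\<close> and nonunits on the side of
      \<open>F'\<close>.\<close>
    show "bumpable Pinf F'" using sub reg F' FinB by (intro F.bumpable_poly) auto
  qed auto
  then obtain y where "\<forall>p\<in>Pinf \<union> F'. (y - xx p) / (t ^ 0 * zz p) \<in> B p"
    unfolding solvable_def by blast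
  then have y: "(y - xx p) / zz p \<in> B p" if "p \<in> Pinf \<union> F'" for p using that by simp

  have "(y - xx p) / zz p \<in> frakB sit K (snd p)" if p: "p \<in> P" for p
  proof -
    consider "p \<in> Pinf" | "p \<in> F'" | "p \<in> Pfin" "p \<notin> F'" using p by (auto simp: Pfin_def)
    then show ?thesis
    proof cases
      case 1
      then show ?thesis using y[of p] InfB by simp
    next
      case 2
      then have "(y - xx p) / zz p \<in> nonunits (R p)" using y[of p] FinB[of p] F' by auto
      then show ?thesis using frakB[OF p] unit_ball.nonunits_subset[OF ball[OF p]] by blast
    next
      case 3
      then obtain q where q: "q \<in> F' \<union> Pinf" "R q \<subseteq> R p" and "sit = Situation_O"
        using dropped by blast
      have qP: "q \<in> P" using q sub by blast
      have yq: "(y - xx q) / zz q \<in> R q" using y[of q] q B_subset[OF qP] by blast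
      have "(y - xx p) / zz p \<in> R p"
      proof (cases "fst q = fst p")
        case True
        then show ?thesis using yq q by (auto simp: xx_def zz_def)
      next
        case False
        let ?M = "R p * R q"
        note M = product[OF p qP False[symmetric]] unit_ball_product[OF ball[OF p] ball[OF qP]]
        \<comment> \<open>As \<open>R q\<close> is contained in \<open>R p\<close>, the product ring
          is contained in \<open>R p\<close>, and the compatibility of \<open>x\<close> and
          \<open>z\<close> in that ring carries the solution from \<open>q\<close> over to the
          dropped point \<open>p\<close>.\<close>
        have "(y - xx q) / zz q * (zz q / zz p) + (xx q - xx p) / zz p \<in> ?M"
          using M yq unit_ball.mult[OF M(2), of "(y - xx q) / zz q" "zz q / zz p"] by blast
        moreover have "(y - xx q) / zz q * (zz q / zz p) + (xx q - xx p) / zz p = (y - xx p) / zz p"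
          using z[OF qP] by (simp flip: add_divide_distrib)
        moreover have "?M \<subseteq> R p"
          using q(2) unit_ball.mult[OF ball[OF p]] by (auto simp: set_times_def)
        ultimately show ?thesis by auto
      qed
      then show ?thesis using \<open>sit = Situation_O\<close> by (simp add: R_def)
    qed
  qed
  then have "(y - x i) / z i \<in> frakB sit K v" if "i \<in> {1..n}" "v \<in> S i" for i v
    using that by (force simp: P_def xx_def zz_def)
  moreover have "y - x i = z i * ((y - x i) / z i)" if "i \<in> {1..n}" for i using z_nonzero that by simp
  ultimately show ?thesis by (intro exI[of _ y]) (metis set_times_intro2)
qed

end
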